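(* Let $G=\mathbb{T}\ltimes\mathbb{Z}_2$, where $\mathbb{T}=\{s\in\mathbb{C}:|s|=1\}$, $\mathbb{Z}_2=\{-1,1\}$, with group law $(s,a)(t,b)=(st^a,ab)$. Then $\mathrm{ZL}^1(G)$ is amenable.
   Context: $G$ is a compact group; $\mathrm{L}^1(G)$ is its convolution algebra (normalised Haar measure) and $\mathrm{ZL}^1(G)$ its centre. A Banach algebra $\mathfrak{A}$ is amenable if it has a bounded approximate diagonal: a bounded net $(\mu_\alpha)$ in $\mathfrak{A}\hat\otimes\mathfrak{A}$ with $m(\mu_\alpha)a\to a$, $a\,m(\mu_\alpha)\to a$, $a\cdot\mu_\alpha-\mu_\alpha\cdot a\to0$ for all $a$ ($m$ multiplication, $a\cdot(b\otimes c)=ab\otimes c$, $(b\otimes c)\cdot a=b\otimes ca$). *)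

theory Defs
  imports "HOL-Analysis.Analysis"
begin

type_synonym grp = "complex \<times> int"
type_synonym fn = "grp \<Rightarrow> complex"

definition G_carrier :: "grp set" where
  "G_carrier = {(s, a). cmod s = 1 \<and> a \<in> {-1, 1}}"

definition gmult :: "grp \<Rightarrow> grp \<Rightarrow> grp" where
  "gmult x y = (fst x * (fst y) powi (snd x), snd x * snd y)"

definition ginv :: "grp \<Rightarrow> grp" where
  "ginv x = ((fst x) powi (- snd x), snd x)"

definition circle_haar :: "complex measure" where
  "circle_haar = distr (uniform_measure lborel {0..2*pi}) borel (\<lambda>\<theta>. cis \<theta>)"

definition sign_haar :: "int measure" where
  "sign_haar = uniform_measure (count_space UNIV) {-1, 1}"

definition haarG :: "grp measure" where
  "haarG = circle_haar \<Otimes>\<^sub>M sign_haar"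

definition l1norm :: "fn \<Rightarrow> real" where
  "l1norm f = (\<integral>x. cmod (f x) \<partial>haarG)"

definition conv :: "fn \<Rightarrow> fn \<Rightarrow> fn" where
  "conv f g = (\<lambda>x. \<integral>y. f y * g (gmult (ginv y) x) \<partial>haarG)"

text \<open>ZL^1(G), represented by (a.e.-classes of) integrable functions\<close>
definition ZL1 :: "fn set" where
  "ZL1 = {f. integrable haarG f \<and>
             (\<forall>g. integrable haarG g \<longrightarrow> (AE x in haarG. conv f g x = conv g f x))}"

text \<open>An element of the projective tensor product is represented by a series
  sum_k u_k \<otimes> v_k with u_k, v_k in the algebra and sum_k |u_k| |v_k| < \<infinity>.\<close>
type_synonym tens = "(nat \<Rightarrow> fn) \<times> (nat \<Rightarrow> fn)"

definition valid_tens :: "tens \<Rightarrow> bool" where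
  "valid_tens \<mu> \<longleftrightarrow> (\<forall>k. fst \<mu> k \<in> ZL1 \<and> snd \<mu> k \<in> ZL1) \<and>
      summable (\<lambda>k. l1norm (fst \<mu> k) * l1norm (snd \<mu> k))"

text \<open>Unit ball of the dual of the projective tensor product: bounded bilinear forms
  on ZL^1 \<times> ZL^1 of norm \<le> 1.\<close>
definition unit_forms :: "(fn \<Rightarrow> fn \<Rightarrow> complex) set" where
  "unit_forms = {\<phi>.
     (\<forall>f\<in>ZL1. \<forall>g\<in>ZL1. \<forall>h\<in>ZL1. \<forall>c.
        \<phi> (\<lambda>x. f x + g x) h = \<phi> f h + \<phi> g h \<and>
        \<phi> h (\<lambda>x. f x + g x) = \<phi> h f + \<phi> h g \<and>
        \<phi> (\<lambda>x. c * f x) h = c * \<phi> f h \<and>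
        \<phi> h (\<lambda>x. c * f x) = c * \<phi> h f) \<and>
     (\<forall>f\<in>ZL1. \<forall>g\<in>ZL1. cmod (\<phi> f g) \<le> l1norm f * l1norm g)}"

definition pair :: "(fn \<Rightarrow> fn \<Rightarrow> complex) \<Rightarrow> tens \<Rightarrow> complex" where
  "pair \<phi> \<mu> = (\<Sum>k. \<phi> (fst \<mu> k) (snd \<mu> k))"

text \<open>projective norm of an element given by its action on bilinear forms
  (norm = sup over the dual unit ball)\<close>
definition proj_norm :: "((fn \<Rightarrow> fn \<Rightarrow> complex) \<Rightarrow> complex) \<Rightarrow> real" where
  "proj_norm T = (SUP \<phi>\<in>unit_forms. cmod (T \<phi>))"

definition lact :: "fn \<Rightarrow> tens \<Rightarrow> tens" where
  "lact a \<mu> = ((\<lambda>k. conv a (fst \<mu> k)), snd \<mu>)"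

definition ract :: "tens \<Rightarrow> fn \<Rightarrow> tens" where
  "ract \<mu> a = (fst \<mu>, (\<lambda>k. conv (snd \<mu> k) a))"

definition mult_tens :: "tens \<Rightarrow> fn" where
  "mult_tens \<mu> = (\<lambda>x. \<Sum>k. conv (fst \<mu> k) (snd \<mu> k) x)"

text \<open>Existence of a bounded approximate diagonal. A net (\<mu>_\<alpha>) is represented by a proper
  filter F on the tensor representatives (the image filter of the net); this is equivalent
  to the existence of a net.\<close>
definition ZL1_amenable :: bool where
  "ZL1_amenable \<longleftrightarrow> (\<exists>F :: tens filter. \<exists>C :: real. F \<noteq> bot \<and>
     (\<forall>\<^sub>F \<mu> in F. valid_tens \<mu> \<and> proj_norm (\<lambda>\<phi>. pair \<phi> \<mu>) \<le> C) \<and>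
     (\<forall>a\<in>ZL1.
        ((\<lambda>\<mu>. l1norm (\<lambda>x. conv (mult_tens \<mu>) a x - a x)) \<longlongrightarrow> 0) F \<and>
        ((\<lambda>\<mu>. l1norm (\<lambda>x. conv a (mult_tens \<mu>) x - a x)) \<longlongrightarrow> 0) F \<and>
        ((\<lambda>\<mu>. proj_norm (\<lambda>\<phi>. pair \<phi> (lact a \<mu>) - pair \<phi> (ract \<mu> a))) \<longlongrightarrow> 0) F))"

end

(* In terms of the minimal idempotents of ZL^1(G) -- the two characters chi 1, chi (-1) and
   e_n = 2 (s^n + s^-n) on the identity component, n >= 1 -- the formal diagonal is
   chi 1 (x) chi 1 + chi (-1) (x) chi (-1) + sum_n e_n (x) e_n.  Truncate it by the weights c_n^2,
   where K(s) = sum_n c_n s^n is a nonnegative trigonometric kernel of mean 1.  Since a e_n is a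
   multiple of e_n for every central a, each truncation commutes with a exactly.  With
   L_r(s) = K(rs) + K(s/r), the main part of the truncation is the average over the circle of
   L_r (x) L_(1/r), and each L_r has norm at most 1 in L^1(G): this bounds the projective norms.
   Multiplying out gives 2 (K * K) on the identity component, again a nonnegative kernel, and the
   density of trigonometric polynomials in L^1 of the circle makes it an approximate identity. *)
theory Submission
  imports Defs "HOL-Probability.Probability_Measure" "HOL-Real_Asymp.Real_Asymp"
begin

section \<open>Haar measure on the circle\<close>


text \<open>The obstacle is boundedness. The sharply truncated diagonal multiplies out to twice the
  Dirichlet kernel on the rotations, and the L^1 norms of that kernel grow without bound; as
  \<open>m\<close> is contractive, the sharp truncations are unbounded as well. Damping by a
  nonnegative kernel repairs this, because positivity turns an L^1 norm into a mean, that is, into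
  the coefficient of frequency 0. The weights are squares because averaging the product of two
  kernels over \<open>r\<close> leaves the product of equal-frequency coefficients. The kernel used
  is \<open>|1 + s|^(2*N)\<close> divided by the central binomial coefficient (de la
  Vallee-Poussin): it is visibly nonnegative, and each of its coefficients is a ratio of binomial
  coefficients tending to 1. The factor 2 in the product compensates the Haar mass 1/2 of the
  rotation component. Centrality enters only through Fourier coefficients: those of a central
  function are symmetric on the rotations and vanish off frequency 0 on the reflections. Elements of
  L^1 are functions here, not classes, so some care goes into null sets and into points of the type
  outside the group.\<close>

lemma sets_circle [simp, measurable_cong]: "sets circle_haar = sets borel"
  by (simp add: circle_haar_def)

lemma space_circle [simp]: "space circle_haar = UNIV"
  by (simp add: circle_haar_def)

lemma cis_measurable [measurable]: "cis \<in> borel_measurable borel"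
  by (intro borel_measurable_continuous_onI continuous_intros)

lemma nn_integral_circle:
  assumes [measurable]: "f \<in> borel_measurable borel"
  shows "(\<integral>\<^sup>+s. f s \<partial>circle_haar)
    = (\<integral>\<^sup>+\<theta>. f (cis \<theta>) * indicator {0..2*pi} \<theta> \<partial>lborel) / ennreal (2*pi)"
  unfolding circle_haar_def
  by (subst nn_integral_distr) (simp_all add: nn_integral_uniform_measure)

lemma prob_space_circle: "prob_space circle_haar"
  unfolding circle_haar_def
  by (intro prob_space.prob_space_distr prob_space_uniform_measure) simp_all

interpretation circle: prob_space circle_haar
  by (rule prob_space_circle)

lemma AE_circle: "AE s in circle_haar. cmod s = 1"
  unfolding circle_haar_def by (subst AE_distr_iff) simp_all

text \<open>The reflection \<open>theta -> 2*pi - theta\<close> maps the parameter interval to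
  itself and turns \<open>cis\<close> into its inverse.\<close>

lemma nn_integral_circle_inverse:
  assumes [measurable]: "f \<in> borel_measurable borel"
  shows "(\<integral>\<^sup>+s. f (inverse s) \<partial>circle_haar) = (\<integral>\<^sup>+s. f s \<partial>circle_haar)"
proof -
  have "(\<integral>\<^sup>+\<theta>. f (cis \<theta>) * indicator {0..2*pi} \<theta> \<partial>lborel)
      = (\<integral>\<^sup>+\<theta>. f (cis (2*pi + (-1) * \<theta>)) * indicator {0..2*pi} (2*pi + (-1) * \<theta>) \<partial>lborel)"
    by (subst nn_integral_real_affine[where c = "-1" and t = "2*pi"]) simp_all
  also have "\<dots> = (\<integral>\<^sup>+\<theta>. f (inverse (cis \<theta>)) * indicator {0..2*pi} \<theta> \<partial>lborel)"
    by (intro nn_integral_cong)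
      (auto simp: indicator_def divide_inverse simp flip: cis_divide simp del: cis_inverse)
  finally show ?thesis
    by (simp add: nn_integral_circle)
qed

text \<open>Rotation by \<open>cis p\<close> replaces the window \<open>{0..2*pi}\<close> by
  \<open>{p..2*pi+p}\<close>; by periodicity the piece below \<open>p\<close> can be cut off and
  reattached at the far end.\<close>

lemma nn_integral_circle_rotate:
  assumes [measurable]: "f \<in> borel_measurable borel" and t: "cmod t = 1"
  shows "(\<integral>\<^sup>+s. f (s * t) \<partial>circle_haar) = (\<integral>\<^sup>+s. f s \<partial>circle_haar)"
proof -
  obtain p where p: "0 \<le> p" "p < 2*pi" "t = cis p"
  proof -
    have "Arg2pi t \<ge> 0" "Arg2pi t < 2*pi" "t = cis (Arg2pi t)"
      using Arg2pi[of t] t by (auto simp: cis_conv_exp is_Arg_def)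
    then show ?thesis using that by blast
  qed
  have split: "{p..2*pi+p} = {p..2*pi} \<union> {2*pi<..2*pi+p}" using p by auto
  have split': "{0..2*pi} = {p..2*pi} \<union> {0..<p}" using p by auto
  \<comment> \<open>The closed end of the piece changes sides, at the cost of two null points, so
    that after the shift by \<open>2*pi\<close> it is disjoint from
    \<open>{p..2*pi}\<close>.\<close>
  have "(\<integral>\<^sup>+\<theta>. f (cis \<theta>) * indicator {0..<p} \<theta> \<partial>lborel)
     = (\<integral>\<^sup>+\<theta>. f (cis \<theta>) * indicator {0<..p} \<theta> \<partial>lborel)"
  proof (intro nn_integral_cong_AE)
    have "AE x in lborel. x \<noteq> 0 \<and> x \<noteq> p"
      using AE_lborel_singleton[of 0] AE_lborel_singleton[of p] by eventually_elim auto
    then show "AE x in lborel. f (cis x) * indicator {0..<p} x = f (cis x) * indicator {0<..p} x"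
      by eventually_elim (auto simp: indicator_def)
  qed
  also have "\<dots> = (\<integral>\<^sup>+\<theta>. f (cis (-2*pi + 1 * \<theta>)) * indicator {0<..p} (-2*pi + 1 * \<theta>) \<partial>lborel)"
    by (subst nn_integral_real_affine[where c = "1" and t = "-2*pi"]) simp_all
  also have "\<dots> = (\<integral>\<^sup>+\<theta>. f (cis \<theta>) * indicator {2*pi<..2*pi+p} \<theta> \<partial>lborel)"
    by (intro nn_integral_cong) (auto simp: indicator_def cis.ctr cos_diff sin_diff)
  finally have shift: "(\<integral>\<^sup>+\<theta>. f (cis \<theta>) * indicator {0..<p} \<theta> \<partial>lborel)
    = (\<integral>\<^sup>+\<theta>. f (cis \<theta>) * indicator {2*pi<..2*pi+p} \<theta> \<partial>lborel)" .
  have "(\<integral>\<^sup>+\<theta>. f (cis \<theta>) * indicator {0..2*pi} \<theta> \<partial>lborel)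
      = (\<integral>\<^sup>+\<theta>. f (cis \<theta>) * indicator {p..2*pi} \<theta> + f (cis \<theta>) * indicator {0..<p} \<theta> \<partial>lborel)"
    unfolding split' by (intro nn_integral_cong) (auto simp: indicator_def)
  also have "\<dots> = (\<integral>\<^sup>+\<theta>. f (cis \<theta>) * indicator {p..2*pi} \<theta>
      + f (cis \<theta>) * indicator {2*pi<..2*pi+p} \<theta> \<partial>lborel)"
    by (simp add: nn_integral_add shift)
  also have "\<dots> = (\<integral>\<^sup>+\<theta>. f (cis \<theta>) * indicator {p..2*pi+p} \<theta> \<partial>lborel)"
    unfolding split by (intro nn_integral_cong) (auto simp: indicator_def)
  also have "\<dots> = (\<integral>\<^sup>+\<theta>. f (cis (p + 1 * \<theta>)) * indicator {p..2*pi+p} (p + 1 * \<theta>) \<partial>lborel)"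
    by (subst nn_integral_real_affine[where c = "1" and t = p]) simp_all
  also have "\<dots> = (\<integral>\<^sup>+\<theta>. f (cis \<theta> * t) * indicator {0..2*pi} \<theta> \<partial>lborel)"
    by (intro nn_integral_cong) (auto simp: indicator_def p cis_mult add.commute)
  finally show ?thesis
    by (simp add: nn_integral_circle)
qed

lemma distr_circle_cong:
  assumes [measurable]: "h \<in> borel_measurable borel"
    and "\<And>f. f \<in> borel_measurable borel \<Longrightarrow>
      (\<integral>\<^sup>+s. f (h s) \<partial>circle_haar) = (\<integral>\<^sup>+s. f s \<partial>circle_haar)"
  shows "distr circle_haar borel h = circle_haar"
proof (rule measure_eqI)
  fix A assume "A \<in> sets (distr circle_haar borel h)"
  then have A [measurable]: "A \<in> sets borel" by simp
  have "emeasure (distr circle_haar borel h) A = (\<integral>\<^sup>+s. indicator A s \<partial>distr circle_haar borel h)"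
    by simp
  also have "\<dots> = (\<integral>\<^sup>+s. indicator A (h s) \<partial>circle_haar)"
    by (rule nn_integral_distr) simp_all
  also have "\<dots> = emeasure circle_haar A"
    using assms(2)[of "indicator A"] by simp
  finally show "emeasure (distr circle_haar borel h) A = emeasure circle_haar A" .
qed simp

lemma distr_circle_right:
  assumes t: "cmod t = 1"
  shows "distr circle_haar borel (\<lambda>s. s * t) = circle_haar"
  by (rule distr_circle_cong) (simp_all add: nn_integral_circle_rotate[OF _ t])

lemma distr_circle_left:
  assumes t: "cmod t = 1"
  shows "distr circle_haar borel (\<lambda>s. inverse s * t) = circle_haar"
proof (rule distr_circle_cong)
  fix f :: "complex \<Rightarrow> ennreal" assume [measurable]: "f \<in> borel_measurable borel"
  show "(\<integral>\<^sup>+s. f (inverse s * t) \<partial>circle_haar) = (\<integral>\<^sup>+s. f s \<partial>circle_haar)"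
    using nn_integral_circle_inverse[of "\<lambda>s. f (s * t)"] nn_integral_circle_rotate[OF _ t, of f]
    by simp
qed simp

lemma powi_measurable [measurable (raw)]:
  fixes f :: "'a \<Rightarrow> complex"
  assumes [measurable]: "f \<in> borel_measurable M"
  shows "(\<lambda>x. f x powi n) \<in> borel_measurable M"
  by (cases "n \<ge> 0") (simp_all add: power_int_def)

lemma integral_circle_powi:
  "(\<integral>s. s powi n \<partial>circle_haar) = (if n = 0 then 1 else 0)"
proof (cases "n = 0")
  case False
  \<comment> \<open>Chosen so that \<open>t powi n = -1\<close>: rotation by \<open>t\<close> then
    equates the integral with its own negative.\<close>
  define t where "t = cis (pi / of_int n)"
  have t: "cmod t = 1" "t powi n = -1"
    using False by (simp_all add: t_def cis_power_int)
  have "(\<integral>s. s powi n \<partial>circle_haar) = (\<integral>s. s powi n \<partial>distr circle_haar borel (\<lambda>s. s * t))"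
    by (simp add: distr_circle_right t)
  also have "\<dots> = (\<integral>s. (s * t) powi n \<partial>circle_haar)"
    by (rule integral_distr) simp_all
  also have "\<dots> = - (\<integral>s. s powi n \<partial>circle_haar)"
    by (simp add: power_int_mult_distrib t)
  finally show ?thesis using False by simp
qed (use circle.prob_space in simp)

section \<open>Density of trigonometric polynomials\<close>


inductive trig :: "(complex \<Rightarrow> complex) \<Rightarrow> bool" where
  monom: "trig (\<lambda>s. c * s powi n)"
| add: "trig f \<Longrightarrow> trig g \<Longrightarrow> trig (\<lambda>s. f s + g s)"

lemma trig_cmult: "trig f \<Longrightarrow> trig (\<lambda>s. c * f s)"
proof (induction rule: trig.induct)
  case (monom d n)
  then show ?case using trig.monom[of "c * d" n] by (simp add: mult.assoc)
qed (simp add: distrib_left trig.add)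

text \<open>\<open>trig\<close> speaks of functions on the whole plane, and at \<open>s = 0\<close>
  the law \<open>s powi (n + m) = s powi n * s powi m\<close> can fail; hence the restriction to
  nonzero \<open>s\<close>.\<close>

lemma trig_mult:
  assumes "trig f" "trig g"
  shows "\<exists>h. trig h \<and> (\<forall>s. s \<noteq> 0 \<longrightarrow> h s = f s * g s)"
  using assms(1)
proof (induction rule: trig.induct)
  case (monom c n)
  from assms(2) show ?case
  proof (induction rule: trig.induct)
    case (monom d m)
    have "trig (\<lambda>s. (c * d) * s powi (n + m))" by (rule trig.monom)
    moreover have "(c * d) * s powi (n + m) = c * s powi n * (d * s powi m)" if "s \<noteq> 0" for s
      using that by (simp add: power_int_add)
    ultimately show ?case by blast
  next
    case (add f g)
    then obtain h1 h2 where h: "trig h1" "trig h2"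
      "\<And>s. s \<noteq> 0 \<Longrightarrow> h1 s = c * s powi n * f s" "\<And>s. s \<noteq> 0 \<Longrightarrow> h2 s = c * s powi n * g s"
      by blast
    then show ?case
      by (intro exI[of _ "\<lambda>s. h1 s + h2 s"]) (auto intro: trig.add simp: distrib_left)
  qed
next
  case (add f1 f2)
  then obtain h1 h2 where h: "trig h1" "trig h2"
    "\<And>s. s \<noteq> 0 \<Longrightarrow> h1 s = f1 s * g s" "\<And>s. s \<noteq> 0 \<Longrightarrow> h2 s = f2 s * g s"
    by blast
  then show ?case
    by (intro exI[of _ "\<lambda>s. h1 s + h2 s"]) (auto intro: trig.add simp: distrib_right)
qed

lemma trig_measurable [measurable (raw)]: "trig f \<Longrightarrow> f \<in> borel_measurable borel"
  by (induction rule: trig.induct) simp_all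

lemma trig_bounded: "trig f \<Longrightarrow> \<exists>B. \<forall>s. cmod s = 1 \<longrightarrow> cmod (f s) \<le> B"
proof (induction rule: trig.induct)
  case (monom c n)
  show ?case by (intro exI[of _ "cmod c"]) (simp add: norm_mult norm_power_int)
next
  case (add f g)
  then obtain B C where "\<And>s. cmod s = 1 \<Longrightarrow> cmod (f s) \<le> B" "\<And>s. cmod s = 1 \<Longrightarrow> cmod (g s) \<le> C"
    by blast
  then show ?case by (intro exI[of _ "B + C"]) (auto intro: norm_triangle_le add_mono)
qed

lemma integrable_circle_bounded:
  fixes f :: "complex \<Rightarrow> 'a::{banach, second_countable_topology}"
  assumes [measurable]: "f \<in> borel_measurable borel" and "\<And>s. cmod s = 1 \<Longrightarrow> norm (f s) \<le> B"
  shows "integrable circle_haar f"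
proof (rule circle.integrable_const_bound)
  show "AE s in circle_haar. norm (f s) \<le> B"
    using AE_circle by eventually_elim (rule assms(2))
qed simp

lemma trig_integrable: "trig f \<Longrightarrow> integrable circle_haar f"
  using trig_bounded[of f] by (auto intro: integrable_circle_bounded)

text \<open>On the circle \<open>cnj s\<close> is \<open>inverse s\<close>, so the real coordinates
  of \<open>s\<close> are combinations of \<open>s\<close> and \<open>inverse s\<close>, and sums
  and products stay within \<open>trig\<close>.\<close>

lemma trig_real_polynomial:
  assumes "real_polynomial_function p"
  shows "\<exists>q. trig q \<and> (\<forall>s. cmod s = 1 \<longrightarrow> q s = complex_of_real (p s))"
  using assms
proof (induction rule: real_polynomial_function.induct)
  case (linear f)
  interpret bounded_linear f by fact
  \<comment> \<open>The coefficients come from \<open>f s = Re s * f 1 + Im s * f \<i>\<close> with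
    \<open>Re s\<close> and \<open>Im s\<close> written through \<open>s\<close> and
    \<open>inverse s\<close>.\<close>
  have "trig (\<lambda>s. (f 1 / 2 - \<i> * f \<i> / 2) * s powi 1 + (f 1 / 2 + \<i> * f \<i> / 2) * s powi (-1))"
    by (intro trig.intros)
  moreover have "(f 1 / 2 - \<i> * f \<i> / 2) * s powi 1 + (f 1 / 2 + \<i> * f \<i> / 2) * s powi (-1)
     = complex_of_real (f s)" if "cmod s = 1" for s
  proof -
    have "s * cnj s = 1"
      using that complex_norm_square[of s] by simp
    then have inv: "inverse s = cnj s"
      by (rule inverse_unique)
    have "f s = f (Re s *\<^sub>R 1 + Im s *\<^sub>R \<i>)"
      by (simp add: mult.commute scaleR_conv_of_real flip: complex_eq)
    then have "f s = Re s * f 1 + Im s * f \<i>"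
      by (simp add: add scale)
    then show ?thesis
      by (simp add: inv complex_eq_iff power_int_minus algebra_simps)
  qed
  ultimately show ?case by blast
next
  case (const c)
  show ?case using trig.monom[of c 0] by (intro exI[of _ "\<lambda>s. complex_of_real c * s powi 0"]) simp
next
  case (add f g)
  then obtain p q where "trig p" "trig q"
    "\<And>s. cmod s = 1 \<Longrightarrow> p s = complex_of_real (f s)" "\<And>s. cmod s = 1 \<Longrightarrow> q s = complex_of_real (g s)"
    by blast
  then show ?case by (intro exI[of _ "\<lambda>s. p s + q s"]) (auto intro: trig.add)
next
  case (mult f g)
  then obtain p q where pq: "trig p" "trig q"
    "\<And>s. cmod s = 1 \<Longrightarrow> p s = complex_of_real (f s)" "\<And>s. cmod s = 1 \<Longrightarrow> q s = complex_of_real (g s)"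
    by blast
  obtain h where "trig h" "\<And>s. s \<noteq> 0 \<Longrightarrow> h s = p s * q s"
    using trig_mult[OF pq(1,2)] by blast
  then have "\<forall>s. cmod s = 1 \<longrightarrow> h s = complex_of_real (f s * g s)"
    using pq by (metis norm_zero of_real_mult zero_neq_one)
  then show ?case using \<open>trig h\<close> by blast
qed

lemma trig_dense_continuous:
  assumes "continuous_on (sphere 0 1) f" "e > 0"
  shows "\<exists>q. trig q \<and> (\<forall>s. cmod s = 1 \<longrightarrow> cmod (f s - q s) < e)"
proof -
  obtain g where g: "polynomial_function g" "\<And>s. s \<in> sphere 0 1 \<Longrightarrow> cmod (f s - g s) < e"
    using Stone_Weierstrass_polynomial_function[OF _ assms] by auto
  have "real_polynomial_function (Re \<circ> g)" "real_polynomial_function (Im \<circ> g)"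
    using g(1)[unfolded polynomial_function_def] by (simp_all add: bounded_linear_Re bounded_linear_Im)
  from this[THEN trig_real_polynomial] obtain p q where pq: "trig p" "trig q"
    "\<forall>s. cmod s = 1 \<longrightarrow> p s = complex_of_real ((Re \<circ> g) s)"
    "\<forall>s. cmod s = 1 \<longrightarrow> q s = complex_of_real ((Im \<circ> g) s)"
    by blast
  have "p s + \<i> * q s = g s" if "cmod s = 1" for s
    using pq that by (simp add: complex_eq_iff)
  moreover have "trig (\<lambda>s. p s + \<i> * q s)"
    by (intro trig.add trig_cmult pq)
  ultimately show ?thesis
    using g(2) by (intro exI[of _ "\<lambda>s. p s + \<i> * q s"]) auto
qed

definition trig_approx :: "(complex \<Rightarrow> complex) \<Rightarrow> bool" where
  "trig_approx f \<longleftrightarrow> integrable circle_haar f \<and>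
    (\<forall>e>0. \<exists>q. trig q \<and> (\<integral>s. cmod (f s - q s) \<partial>circle_haar) < e)"

lemma integral_norm_triangle:
  fixes f g h :: "'a \<Rightarrow> 'b::{banach, second_countable_topology}"
  assumes "integrable M f" "integrable M g" "integrable M h"
  shows "(\<integral>x. norm (f x - h x) \<partial>M) \<le> (\<integral>x. norm (f x - g x) \<partial>M) + (\<integral>x. norm (g x - h x) \<partial>M)"
proof -
  have "(\<integral>x. norm (f x - h x) \<partial>M) \<le> (\<integral>x. norm (f x - g x) + norm (g x - h x) \<partial>M)"
    using assms by (intro integral_mono) (auto intro!: norm_diff_triangle_le[OF order_refl order_refl])
  also have "\<dots> = (\<integral>x. norm (f x - g x) \<partial>M) + (\<integral>x. norm (g x - h x) \<partial>M)"
    using assms by (intro Bochner_Integration.integral_add) auto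
  finally show ?thesis .
qed

lemma trig_approx_closed:
  assumes "integrable circle_haar f"
    and "\<And>e. e > 0 \<Longrightarrow> \<exists>g. trig_approx g \<and> (\<integral>s. cmod (f s - g s) \<partial>circle_haar) < e"
  shows "trig_approx f"
  unfolding trig_approx_def
proof (intro conjI allI impI)
  fix e :: real assume "e > 0"
  then obtain g where g: "trig_approx g" "(\<integral>s. cmod (f s - g s) \<partial>circle_haar) < e/2"
    using assms(2)[of "e/2"] by auto
  then obtain q where q: "trig q" "(\<integral>s. cmod (g s - q s) \<partial>circle_haar) < e/2"
    unfolding trig_approx_def using half_gt_zero[OF \<open>e > 0\<close>] by blast
  have "(\<integral>s. cmod (f s - q s) \<partial>circle_haar) < e"
    using integral_norm_triangle[of circle_haar f g q] assms(1) g q trig_integrable[OF q(1)]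
    by (auto simp: trig_approx_def)
  then show "\<exists>q. trig q \<and> (\<integral>s. cmod (f s - q s) \<partial>circle_haar) < e" using q by auto
qed fact

text \<open>Dominated convergence makes a pointwise limit an L^1 limit. This serves three times: for
  closed sets, for disjoint unions and for the passage from simple functions to integrable
  ones.\<close>

lemma trig_approx_lim:
  assumes f: "\<And>n. trig_approx (f n)" and [measurable]: "g \<in> borel_measurable borel"
    and w: "integrable circle_haar w"
    and lim: "\<And>s. (\<lambda>n. f n s) \<longlonglongrightarrow> g s"
    and bd: "\<And>n s. cmod (f n s) \<le> w s"
  shows "trig_approx g"
proof (rule trig_approx_closed)
  have [measurable]: "f n \<in> borel_measurable borel" for n
    using f[of n] borel_measurable_integrable unfolding trig_approx_def by fastforce
  show int: "integrable circle_haar g"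
    by (rule integrable_dominated_convergence[OF _ _ w, of _ f]) (use lim bd in auto)
  have bdg: "cmod (g s) \<le> w s" for s
    by (rule Lim_bounded[OF tendsto_norm[OF lim], of 0]) (use bd in auto)
  have "(\<lambda>n. \<integral>s. cmod (g s - f n s) \<partial>circle_haar) \<longlonglongrightarrow> (\<integral>s. 0 \<partial>circle_haar)"
  proof (rule integral_dominated_convergence[where w = "\<lambda>s. w s + w s"])
    show "AE s in circle_haar. (\<lambda>n. cmod (g s - f n s)) \<longlonglongrightarrow> 0"
      by (intro AE_I2 tendsto_norm_zero) (metis tendsto_diff[OF tendsto_const lim] diff_self)
    show "AE s in circle_haar. norm (cmod (g s - f n s)) \<le> w s + w s" for n
      using bd bdg by (intro AE_I2) (metis add_mono norm_triangle_ineq4 order_trans real_norm_def abs_norm_cancel)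
  qed (use w in auto)
  then have "eventually (\<lambda>n. (\<integral>s. cmod (g s - f n s) \<partial>circle_haar) < e) sequentially" if "e > 0" for e
    using that by (intro order_tendstoD(2)) auto
  then show "\<exists>h. trig_approx h \<and> (\<integral>s. cmod (g s - h s) \<partial>circle_haar) < e" if "e > 0" for e
    using that f by (meson eventually_sequentially order_refl)
qed

lemma trig_approx_continuous:
  assumes "continuous_on UNIV f"
  shows "trig_approx f"
proof -
  have f: "integrable circle_haar f"
  proof -
    have "compact (f ` sphere 0 1)"
      by (intro compact_continuous_image continuous_on_subset[OF assms]) auto
    then obtain B where "\<And>s. cmod s = 1 \<Longrightarrow> cmod (f s) \<le> B"
      using compact_imp_bounded[THEN bounded_iff[THEN iffD1]] by force
    then show ?thesis
      using borel_measurable_continuous_onI[OF assms] by (intro integrable_circle_bounded) auto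
  qed
  show ?thesis
    unfolding trig_approx_def
  proof (intro conjI allI impI)
    fix e :: real assume "e > 0"
    then obtain q where q: "trig q" "\<And>s. cmod s = 1 \<Longrightarrow> cmod (f s - q s) < e/2"
      using trig_dense_continuous[OF continuous_on_subset[OF assms], of "e/2"] by auto
    have "(\<integral>s. cmod (f s - q s) \<partial>circle_haar) \<le> (\<integral>s. e/2 \<partial>circle_haar)"
    proof (rule integral_mono_AE)
      show "AE s in circle_haar. cmod (f s - q s) \<le> e/2"
        using AE_circle by eventually_elim (use q(2) in force)
    qed (use f trig_integrable[OF q(1)] in auto)
    also have "\<dots> < e" using \<open>e > 0\<close> circle.prob_space by simp
    finally show "\<exists>q. trig q \<and> (\<integral>s. cmod (f s - q s) \<partial>circle_haar) < e" using q by auto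
  qed (fact f)
qed

lemma trig_approx_add:
  assumes f: "trig_approx f" and g: "trig_approx g"
  shows "trig_approx (\<lambda>s. f s + g s)"
  unfolding trig_approx_def
proof (intro conjI allI impI)
  show "integrable circle_haar (\<lambda>s. f s + g s)" using assms by (auto simp: trig_approx_def)
  fix e :: real assume "e > 0"
  then obtain p q where pq: "trig p" "(\<integral>s. cmod (f s - p s) \<partial>circle_haar) < e/2"
     "trig q" "(\<integral>s. cmod (g s - q s) \<partial>circle_haar) < e/2"
    using f g half_gt_zero[OF \<open>e > 0\<close>] unfolding trig_approx_def by blast
  have "(\<integral>s. cmod ((f s + g s) - (p s + q s)) \<partial>circle_haar)
      \<le> (\<integral>s. cmod (f s - p s) + cmod (g s - q s) \<partial>circle_haar)"
    using f g trig_integrable[OF pq(1)] trig_integrable[OF pq(3)]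
    by (intro integral_mono norm_diff_triangle_ineq) (auto simp: trig_approx_def)
  also have "\<dots> = (\<integral>s. cmod (f s - p s) \<partial>circle_haar) + (\<integral>s. cmod (g s - q s) \<partial>circle_haar)"
    using f g trig_integrable[OF pq(1)] trig_integrable[OF pq(3)]
    by (intro Bochner_Integration.integral_add) (auto simp: trig_approx_def)
  finally show "\<exists>q. trig q \<and> (\<integral>s. cmod (f s + g s - q s) \<partial>circle_haar) < e"
    using pq by (intro exI[of _ "\<lambda>s. p s + q s"]) (auto intro: trig.add)
qed

lemma trig_approx_cmult:
  assumes f: "trig_approx f"
  shows "trig_approx (\<lambda>s. c * f s)"
  unfolding trig_approx_def
proof (intro conjI allI impI)
  show "integrable circle_haar (\<lambda>s. c * f s)" using assms by (auto simp: trig_approx_def)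
  fix e :: real assume "e > 0"
  then have "e / (cmod c + 1) > 0"
    by (intro divide_pos_pos add_nonneg_pos) auto
  then obtain p where p: "trig p" "(\<integral>s. cmod (f s - p s) \<partial>circle_haar) < e / (cmod c + 1)"
    using f unfolding trig_approx_def by blast
  have "(\<integral>s. cmod (c * f s - c * p s) \<partial>circle_haar) = cmod c * (\<integral>s. cmod (f s - p s) \<partial>circle_haar)"
    by (simp only: right_diff_distrib[symmetric] norm_mult integral_mult_right_zero)
  also have "\<dots> \<le> cmod c * (e / (cmod c + 1))"
    using p by (intro mult_left_mono) auto
  also have "\<dots> < e"
    using \<open>e > 0\<close> add_nonneg_pos[OF norm_ge_zero[of c] zero_less_one]
    by (simp add: pos_divide_less_eq distrib_left mult.commute)
  finally show "\<exists>q. trig q \<and> (\<integral>s. cmod (c * f s - q s) \<partial>circle_haar) < e"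
    using p by (intro exI[of _ "\<lambda>s. c * p s"]) (auto intro: trig_cmult)
qed

lemma trig_approx_indicator_closed:
  assumes "closed S"
  shows "trig_approx (indicator S)"
proof (cases "S = {}")
  \<comment> \<open>\<open>infdist s {}\<close> is 0 by convention, so the functions used for
    nonempty \<open>S\<close> would here converge to 1.\<close>
  case True
  then show ?thesis using trig_approx_continuous[of "\<lambda>_. 0"] by (simp add: True indicator_def[abs_def])
next
  case False
  \<comment> \<open>Continuous functions equal to 1 on \<open>S\<close> that, for
    \<open>n > 0\<close>, vanish at distance at least \<open>1/n\<close> from it.\<close>
  define f where "f n s = complex_of_real (max 0 (1 - real n * infdist s S))" for n s
  show ?thesis
  proof (rule trig_approx_lim[where w = "\<lambda>_. 1"])
    show "trig_approx (f n)" for n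
      unfolding f_def by (intro trig_approx_continuous continuous_intros)
    show "indicator S \<in> borel_measurable borel" using assms by simp
    show "cmod (f n s) \<le> 1" for n s by (simp add: f_def infdist_nonneg)
    show "(\<lambda>n. f n s) \<longlonglongrightarrow> indicator S s" for s
    proof (cases "s \<in> S")
      case True
      then show ?thesis by (simp add: f_def)
    next
      case notin: False
      then have pos: "infdist s S > 0"
        using assms False by (metis in_closed_iff_infdist_zero infdist_nonneg less_eq_real_def)
      obtain m where "real m * infdist s S > 1"
        using pos reals_Archimedean3 by blast
      then have "f n s = 0" if "n \<ge> m" for n
        using that order_less_le_trans[OF _ mult_right_mono[of "real m" "real n" "infdist s S"]] pos
        by (fastforce simp: f_def max_def)
      then have "eventually (\<lambda>n. f n s = indicator S s) sequentially"
        using notin by (auto intro!: eventually_sequentiallyI)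
      then show ?thesis by (rule tendsto_eventually)
    qed
  qed simp
qed

text \<open>Dynkin's argument: the closed sets are an intersection-stable generator, complements are
  \<open>1 - indicator\<close>, and disjoint unions are limits of finite sums.\<close>

lemma trig_approx_indicator:
  assumes "A \<in> sets borel"
  shows "trig_approx (indicator A)"
proof -
  have borel: "sets borel = sigma_sets UNIV (Collect closed :: complex set set)"
    by (simp add: borel_eq_closed)
  have "Int_stable (Collect closed :: complex set set)" by (auto simp: Int_stable_def)
  then show ?thesis
    using subset_trans[OF subset_UNIV[of "Collect closed"] eq_refl[OF Pow_UNIV[symmetric]]] assms[unfolded borel]
  proof (induction A rule: sigma_sets_induct_disjoint)
    case (basic A)
    then show ?case by (simp add: trig_approx_indicator_closed)
  next
    case empty
    show ?case by (rule trig_approx_indicator_closed) simp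
  next
    case (compl A)
    have "trig_approx (\<lambda>s. 1 + (-1) * indicator A s)"
      by (intro trig_approx_add trig_approx_cmult compl trig_approx_continuous) auto
    also have "(\<lambda>s. 1 + (-1) * indicator A s) = (indicator (UNIV - A) :: complex \<Rightarrow> complex)"
      by (auto simp: indicator_def)
    finally show ?case .
  next
    case (union A)
    show ?case
    proof (rule trig_approx_lim[where w = "\<lambda>_. 1"])
      show "trig_approx (indicator (\<Union>i<n. A i))" for n
      proof (induction n)
        case (Suc n)
        have "(indicator (\<Union>i<Suc n. A i) :: complex \<Rightarrow> complex) = (\<lambda>s. indicator (\<Union>i<n. A i) s + indicator (A n) s)"
        proof
          fix s
          have "A i \<inter> A n = {}" if "i < n" for i
            using union(1) that by (auto simp: disjoint_family_on_def)
          then have "s \<in> A n \<Longrightarrow> \<forall>i<n. s \<notin> A i"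
            by blast
          then show "indicator (\<Union>i<Suc n. A i) s
            = (indicator (\<Union>i<n. A i) s + indicator (A n) s :: complex)"
            by (auto simp: indicator_def lessThan_Suc)
        qed
        then show ?case using trig_approx_add[OF Suc union(3)] by simp
      qed (use trig_approx_continuous[of "\<lambda>_. 0"] in simp)
      show "(\<lambda>n. indicator (\<Union>i<n. A i) s) \<longlonglongrightarrow> (indicator (\<Union>i. A i) s :: complex)" for s
        by (rule LIMSEQ_indicator_UN)
      show "indicator (\<Union>i. A i) \<in> borel_measurable (borel :: complex measure)"
        using union(2) unfolding borel[symmetric]
        by (intro borel_measurable_indicator sets.countable_UN'') auto
    qed (auto simp: indicator_def)
  qed
qed

lemma trig_dense:
  assumes "integrable circle_haar f"
  shows "trig_approx f"
  using assms
proof (induction rule: integrable_induct)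
  case (base A c)
  have "trig_approx (\<lambda>s. c * indicator A s)"
    using base by (intro trig_approx_cmult trig_approx_indicator) simp
  also have "(\<lambda>s. c * indicator A s) = (\<lambda>s. indicator A s *\<^sub>R c)"
    by (auto simp: indicator_def)
  finally show ?case .
next
  case (add f g)
  then show ?case by (intro trig_approx_add)
next
  case (lim f s)
  show ?case
    by (rule trig_approx_lim[OF lim(5), where w = "\<lambda>x. 2 * cmod (f x)"]) (use lim in auto)
qed

section \<open>A positive summability kernel\<close>


text \<open>Frequencies from \<open>-N\<close> to \<open>N\<close> are stored with offset
  \<open>N\<close>, matching the row \<open>2*N\<close> of binomial coefficients: the mean is
  \<open>a N\<close>, and evenness is the symmetry \<open>k -> 2*N - k\<close>.\<close>

definition kern :: "(nat \<Rightarrow> real) \<Rightarrow> nat \<Rightarrow> complex \<Rightarrow> complex" where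
  "kern a N s = (\<Sum>k\<le>2*N. of_real (a k) * s powi (int k - int N))"

lemma trig_sum: "finite A \<Longrightarrow> trig (\<lambda>s. \<Sum>k\<in>A. c k * s powi n k)"
proof (induction A rule: finite_induct)
  case empty
  show ?case using trig.monom[of 0 0] by simp
qed (auto intro: trig.intros)

lemma trig_kern: "trig (kern a N)"
  unfolding kern_def by (intro trig_sum) simp

lemma kern_measurable [measurable]: "kern a N \<in> borel_measurable borel"
  by (intro trig_measurable trig_kern)

section \<open>Fourier coefficients and convolution on the circle\<close>

lemma integrable_powi [simp]: "integrable circle_haar (\<lambda>s. s powi n)"
  using trig_integrable[OF trig.monom[of 1 n]] by simp

lemma integrable_mult_powi:
  assumes "integrable circle_haar f"
  shows "integrable circle_haar (\<lambda>s. f s * s powi n)"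
proof (rule Bochner_Integration.integrable_bound[OF assms])
  show "AE s in circle_haar. cmod (f s * s powi n) \<le> cmod (f s)"
    using AE_circle by eventually_elim (simp add: norm_mult norm_power_int)
qed (use assms in simp)

definition fourier :: "(complex \<Rightarrow> complex) \<Rightarrow> int \<Rightarrow> complex" where
  "fourier f n = (\<integral>s. f s * s powi (- n) \<partial>circle_haar)"

lemma fourier_powi: "fourier (\<lambda>s. s powi m) n = (if m = n then 1 else 0)"
proof -
  have "fourier (\<lambda>s. s powi m) n = (\<integral>s. s powi (m - n) \<partial>circle_haar)"
    unfolding fourier_def
  proof (rule integral_cong_AE)
    show "AE s in circle_haar. s powi m * s powi (- n) = s powi (m - n)"
      using AE_circle
    proof eventually_elim
      case (elim s)
      then have "s \<noteq> 0" by auto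
      then show ?case by (simp flip: power_int_add)
    qed
  qed simp_all
  then show ?thesis by (simp add: integral_circle_powi)
qed

definition cconv :: "(complex \<Rightarrow> complex) \<Rightarrow> (complex \<Rightarrow> complex) \<Rightarrow> complex \<Rightarrow> complex" where
  "cconv f g t = (\<integral>s. f s * g (inverse s * t) \<partial>circle_haar)"

lemma integrable_mult_bounded:
  assumes f: "integrable circle_haar f" and [measurable]: "h \<in> borel_measurable borel"
    and h: "\<And>s. cmod s = 1 \<Longrightarrow> cmod (h s) \<le> B"
  shows "integrable circle_haar (\<lambda>s. f s * h s)"
proof (rule Bochner_Integration.integrable_bound)
  show "integrable circle_haar (\<lambda>s. f s * of_real B)" using f by simp
  show "AE s in circle_haar. cmod (f s * h s) \<le> cmod (f s * of_real B)"
    using AE_circle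
  proof eventually_elim
    case (elim s)
    then have "cmod (h s) \<le> \<bar>B\<bar>" using h[of s] by linarith
    then show ?case by (simp add: norm_mult mult_left_mono)
  qed
qed (use f in measurable)

text \<open>Expanding the kernel turns the convolution into a Fourier multiplier. The identity holds
  for every complex \<open>t\<close>, so the result is a \<open>trig\<close> function outright and
  not only on the circle.\<close>

lemma cconv_kern:
  assumes "integrable circle_haar f"
  shows "cconv f (kern a N) t
    = (\<Sum>k\<le>2*N. of_real (a k) * fourier f (int k - int N) * t powi (int k - int N))"
proof -
  have "cconv f (kern a N) t
    = (\<integral>s. (\<Sum>k\<le>2*N. (of_real (a k) * t powi (int k - int N)) * (f s * s powi (- (int k - int N)))) \<partial>circle_haar)"
    unfolding cconv_def kern_def sum_distrib_left
    by (intro Bochner_Integration.integral_cong refl sum.cong)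
      (simp only: power_int_mult_distrib power_int_minus power_int_inverse mult_ac)
  also have "\<dots> = (\<Sum>k\<le>2*N. (of_real (a k) * t powi (int k - int N)) * fourier f (int k - int N))"
    unfolding fourier_def
    using integrable_mult_powi[OF assms] by (subst Bochner_Integration.integral_sum) simp_all
  finally show ?thesis by (simp add: mult_ac)
qed

lemma trig_cconv_kern: "integrable circle_haar f \<Longrightarrow> trig (cconv f (kern a N))"
  by (subst ext[OF cconv_kern]) (auto intro: trig_sum)

lemma integral_kern:
  assumes "cmod c = 1"
  shows "(\<integral>s. kern a N (c * s) \<partial>circle_haar) = of_real (a N)"
proof -
  have "(\<integral>s. kern a N (c * s) \<partial>circle_haar)
     = (\<Sum>k\<le>2*N. of_real (a k) * c powi (int k - int N) * (if k = N then 1 else 0))"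
    unfolding kern_def
    by (subst Bochner_Integration.integral_sum)
       (auto simp: power_int_mult_distrib integral_circle_powi intro!: sum.cong)
  also have "\<dots> = (\<Sum>k\<in>{N}. of_real (a k) * c powi (int k - int N))"
    by (rule sum.mono_neutral_cong_right) auto
  finally show ?thesis by simp
qed

text \<open>Nonnegativity on the circle for a complex-valued function, in the form that lets
  \<open>cmod\<close> be dropped under the integral.\<close>

definition pos_kern :: "(complex \<Rightarrow> complex) \<Rightarrow> bool" where
  "pos_kern K \<longleftrightarrow> (\<forall>s. cmod s = 1 \<longrightarrow> K s = of_real (cmod (K s)))"

lemma integral_norm_kern:
  assumes "pos_kern (kern a N)" "cmod c = 1"
  shows "(\<integral>s. cmod (kern a N (c * s)) \<partial>circle_haar) = a N"
proof -
  have "complex_of_real (\<integral>s. cmod (kern a N (c * s)) \<partial>circle_haar)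
      = (\<integral>s. of_real (cmod (kern a N (c * s))) \<partial>circle_haar)"
    by (rule integral_complex_of_real[symmetric])
  also have "\<dots> = (\<integral>s. kern a N (c * s) \<partial>circle_haar)"
  proof (rule integral_cong_AE)
    show "AE s in circle_haar. of_real (cmod (kern a N (c * s))) = kern a N (c * s)"
      using AE_circle
    proof eventually_elim
      case (elim s)
      then have "cmod (c * s) = 1" using assms(2) by (simp add: norm_mult)
      then show ?case using assms(1) unfolding pos_kern_def by metis
    qed
  qed simp_all
  also have "\<dots> = of_real (a N)" by (rule integral_kern) fact
  finally show ?thesis by (simp only: of_real_eq_iff)
qed

section \<open>Binomial weights and the positivity of their squares\<close>

text \<open>Fourier coefficients of the de la Vallee-Poussin kernel, normalised so that the mean is
  1.\<close>

definition kap :: "nat \<Rightarrow> nat \<Rightarrow> real" where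
  "kap N k = real ((2*N) choose k) / real ((2*N) choose N)"

lemma kap_centre: "kap N N = 1"
  by (simp add: kap_def)

lemma kap_sym: "k \<le> 2*N \<Longrightarrow> kap N (2*N - k) = kap N k"
  by (simp add: kap_def binomial_symmetric[of k "2*N"])

text \<open>Binomial theorem for \<open>((1 + s)\<^sup>2 / s) ^ N\<close>, where \<open>(1 + s)\<^sup>2 / s = \<bar>1 + s\<bar>\<^sup>2\<close> on the circle.\<close>

lemma kern_kap:
  assumes "cmod s = 1"
  shows "kern (kap N) N s = of_real (cmod (1 + s) ^ (2*N) / real ((2*N) choose N))"
proof -
  have s: "s \<noteq> 0" "s * cnj s = 1"
    using assms complex_norm_square[of s] by auto
  have "(\<Sum>k\<le>2*N. of_nat ((2*N) choose k) * s powi (int k - int N))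
      = (\<Sum>k\<le>2*N. of_nat ((2*N) choose k) * s ^ k * 1 ^ (2*N - k)) / s ^ N"
    using s by (simp add: power_int_diff sum_divide_distrib)
  also have "\<dots> = (s + 1) ^ (2*N) / s ^ N"
    by (simp only: binomial_ring)
  also have "\<dots> = ((s + 1)\<^sup>2) ^ N / s ^ N"
    by (simp only: power_mult)
  also have "\<dots> = ((s + 1)\<^sup>2 / s) ^ N"
    by (simp add: power_divide)
  also have "(s + 1)\<^sup>2 / s = of_real ((cmod (1 + s))\<^sup>2)"
    using s unfolding complex_norm_square
    by (simp add: field_simps power2_eq_square)
  finally have "(\<Sum>k\<le>2*N. of_nat ((2*N) choose k) * s powi (int k - int N)) = of_real (cmod (1 + s) ^ (2*N))"
    by (simp add: power_mult)
  then show ?thesis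
    by (simp add: kern_def kap_def flip: sum_divide_distrib)
qed

lemma pos_kern_kap: "pos_kern (kern (kap N) N)"
  by (simp add: pos_kern_def kern_kap norm_divide norm_power)

text \<open>Squaring the coefficients is convolving the kernel with itself, and a convolution of
  nonnegative functions is nonnegative.\<close>

lemma pos_kern_kap_square: "pos_kern (kern (\<lambda>k. (kap N k)\<^sup>2) N)"
  unfolding pos_kern_def
proof (intro allI impI)
  fix s :: complex assume s: "cmod s = 1"
  let ?K = "kern (kap N) N"
  have four: "fourier ?K (int m - int N) = of_real (kap N m)" if "m \<le> 2*N" for m
  proof -
    have "fourier ?K (int m - int N)
      = (\<Sum>k\<le>2*N. of_real (kap N k) * fourier (\<lambda>s. s powi (int k - int N)) (int m - int N))"
      unfolding fourier_def kern_def sum_distrib_right mult.assoc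
      using integrable_mult_powi[OF integrable_powi]
      by (subst Bochner_Integration.integral_sum) simp_all
    also have "\<dots> = (\<Sum>k\<in>{m}. of_real (kap N k))"
      using that by (intro sum.mono_neutral_cong_right) (auto simp: fourier_powi)
    finally show ?thesis by simp
  qed
  have "kern (\<lambda>k. (kap N k)\<^sup>2) N s = cconv ?K ?K s"
    by (simp add: cconv_kern[OF trig_integrable[OF trig_kern]] four kern_def power2_eq_square)
  also have "\<dots> = (\<integral>r. of_real (cmod (?K r) * cmod (?K (inverse r * s))) \<partial>circle_haar)"
    unfolding cconv_def
  proof (rule integral_cong_AE)
    show "AE r in circle_haar. ?K r * ?K (inverse r * s) = of_real (cmod (?K r) * cmod (?K (inverse r * s)))"
      using AE_circle
    proof eventually_elim
      case (elim r)
      then have "cmod (inverse r * s) = 1" using s by (simp add: norm_mult norm_inverse)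
      then show ?case using pos_kern_kap elim unfolding pos_kern_def by (metis of_real_mult)
    qed
  qed simp_all
  also have "\<dots> = of_real (\<integral>r. cmod (?K r) * cmod (?K (inverse r * s)) \<partial>circle_haar)"
    by (rule integral_complex_of_real)
  finally have "kern (\<lambda>k. (kap N k)\<^sup>2) N s = of_real (\<integral>r. cmod (?K r) * cmod (?K (inverse r * s)) \<partial>circle_haar)" .
  moreover have "(\<integral>r. cmod (?K r) * cmod (?K (inverse r * s)) \<partial>circle_haar) \<ge> 0"
    by (intro Bochner_Integration.integral_nonneg) simp
  ultimately show "kern (\<lambda>k. (kap N k)\<^sup>2) N s = of_real (cmod (kern (\<lambda>k. (kap N k)\<^sup>2) N s))"
    by simp
qed

text \<open>Neighbouring binomial coefficients have ratio \<open>(N - n) / (N + n + 1)\<close>,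
  which tends to 1 for fixed \<open>n\<close>; the limit follows by a product of \<open>n\<close>
  such factors.\<close>

lemma kap_nat_tendsto: "(\<lambda>N. kap N (N + n)) \<longlonglongrightarrow> 1"
proof (induction n)
  case 0
  show ?case by (simp add: kap_centre)
next
  case (Suc n)
  have step: "kap N (N + Suc n) = kap N (N + n) * ((real N - real n) / (real N + real n + 1))" if "N \<ge> n" for N
  proof -
    have "Suc (N + n) * ((2*N) choose Suc (N + n)) = ((2*N) - (N + n)) * ((2*N) choose (N + n))"
      by (metis binomial_absorb_comp binomial_absorption mult.commute)
    then have "real (Suc (N + n)) * real ((2*N) choose Suc (N + n)) = real ((2*N) - (N + n)) * real ((2*N) choose (N + n))"
      by (simp only: of_nat_mult[symmetric])
    moreover have "real ((2*N) - (N + n)) = real N - real n" using that by simp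
    ultimately have "real ((2*N) choose Suc (N + n)) = real ((2*N) choose (N + n)) * ((real N - real n) / (real N + real n + 1))"
      by (simp add: field_simps)
    then show ?thesis by (simp add: kap_def)
  qed
  have "(\<lambda>N. (real N - real n) / (real N + real n + 1)) \<longlonglongrightarrow> 1"
    by real_asymp
  from tendsto_mult[OF Suc this]
  have "(\<lambda>N. kap N (N + n) * ((real N - real n) / (real N + real n + 1))) \<longlonglongrightarrow> 1" by simp
  then show ?case
    by (rule Lim_transform_eventually) (rule eventually_sequentiallyI[of n], rule step[symmetric])
qed

lemma kap_tendsto: "(\<lambda>N. kap N (nat (int N + n))) \<longlonglongrightarrow> 1"
proof (cases "n \<ge> 0")
  case True
  then have "nat (int N + n) = N + nat n" for N by auto
  then show ?thesis using kap_nat_tendsto[of "nat n"] by simp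
next
  case False
  \<comment> \<open>For smaller \<open>N\<close> the frequency \<open>n\<close> lies outside the
    kernel and \<open>nat\<close> cuts its index off at 0, so the symmetry is available only
    eventually.\<close>
  have "kap N (N + nat (- n)) = kap N (nat (int N + n))" if "N \<ge> nat (- n)" for N
  proof -
    have "nat (int N + n) = 2*N - (N + nat (- n))" using that False by auto
    moreover have "kap N (2*N - (N + nat (- n))) = kap N (N + nat (- n))"
      by (rule kap_sym) (use that in simp)
    ultimately show ?thesis by simp
  qed
  then show ?thesis
    by (intro Lim_transform_eventually[OF kap_nat_tendsto[of "nat (- n)"]])
      (auto intro!: eventually_sequentiallyI[of "nat (- n)"])
qed

section \<open>The squared kernels as an approximate identity in L^1 of the circle\<close>

text \<open>Young's inequality by Tonelli: every translate of the kernel has norm equal to its mean,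
  which is 1.\<close>

lemma cconv_kern_contract:
  assumes f: "integrable circle_haar f" and K: "pos_kern (kern a N)" and a: "a N = 1"
  shows "(\<integral>t. cmod (cconv f (kern a N) t) \<partial>circle_haar) \<le> (\<integral>t. cmod (f t) \<partial>circle_haar)"
proof -
  interpret P: pair_sigma_finite circle_haar circle_haar ..
  let ?K = "kern a N"
  have [measurable]: "f \<in> borel_measurable borel"
    using borel_measurable_integrable[OF f] by simp
  have K_int: "(\<integral>\<^sup>+t. ennreal (cmod (?K (inverse s * t))) \<partial>circle_haar) = 1" if "cmod s = 1" for s
  proof -
    have c: "cmod (inverse s) = 1" using that by (simp add: norm_inverse)
    have "integrable circle_haar (\<lambda>t. ?K (inverse s * t))"
    proof -
      obtain B where "\<forall>t. cmod t = 1 \<longrightarrow> cmod (?K t) \<le> B" using trig_bounded[OF trig_kern] by blast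
      then show ?thesis
        using c by (intro integrable_circle_bounded[of _ B]) (auto simp: norm_mult)
    qed
    then show ?thesis
      by (subst nn_integral_eq_integral) (simp_all add: integral_norm_kern[OF K c] a)
  qed
  have "ennreal (\<integral>t. cmod (cconv f ?K t) \<partial>circle_haar) = (\<integral>\<^sup>+t. cmod (cconv f ?K t) \<partial>circle_haar)"
    using trig_integrable[OF trig_cconv_kern[OF f]] by (subst nn_integral_eq_integral) simp_all
  also have "\<dots> \<le> (\<integral>\<^sup>+t. (\<integral>\<^sup>+s. ennreal (cmod (f s)) * ennreal (cmod (?K (inverse s * t))) \<partial>circle_haar) \<partial>circle_haar)"
  proof (rule nn_integral_mono)
    fix t
    show "ennreal (cmod (cconv f ?K t))
      \<le> (\<integral>\<^sup>+s. ennreal (cmod (f s)) * ennreal (cmod (?K (inverse s * t))) \<partial>circle_haar)"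
    \<comment> \<open>The estimate is taken at every \<open>t\<close> of the plane; where the
      integrand is not integrable, the Bochner integral is 0 by convention.\<close>
    proof (cases "integrable circle_haar (\<lambda>s. f s * ?K (inverse s * t))")
      case True
      from integral_norm_bound_ennreal[OF this] show ?thesis
        by (simp add: cconv_def norm_mult ennreal_mult)
    next
      case False
      then show ?thesis by (simp add: cconv_def not_integrable_integral_eq)
    qed
  qed
  also have "\<dots> = (\<integral>\<^sup>+s. (\<integral>\<^sup>+t. ennreal (cmod (f s)) * ennreal (cmod (?K (inverse s * t))) \<partial>circle_haar) \<partial>circle_haar)"
    by (rule P.Fubini') measurable
  also have "\<dots> = (\<integral>\<^sup>+s. ennreal (cmod (f s)) \<partial>circle_haar)"
  proof (rule nn_integral_cong_AE)
    show "AE s in circle_haar. (\<integral>\<^sup>+t. ennreal (cmod (f s)) * ennreal (cmod (?K (inverse s * t))) \<partial>circle_haar) = ennreal (cmod (f s))"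
      using AE_circle by eventually_elim (simp add: nn_integral_cmult K_int)
  qed
  also have "\<dots> = ennreal (\<integral>t. cmod (f t) \<partial>circle_haar)"
    using f by (subst nn_integral_eq_integral) simp_all
  finally show ?thesis
    by (subst (asm) ennreal_le_iff) (auto intro: Bochner_Integration.integral_nonneg)
qed

text \<open>A monomial of frequency \<open>n\<close> is an eigenfunction, with eigenvalue the
  squared weight of \<open>n\<close>, which tends to 1; subadditivity of the error handles
  sums.\<close>

lemma cconv_approx_trig:
  assumes "trig q"
  shows "(\<lambda>N. \<integral>t. cmod (cconv q (kern (\<lambda>k. (kap N k)\<^sup>2) N) t - q t) \<partial>circle_haar) \<longlonglongrightarrow> 0"
  using assms
proof (induction rule: trig.induct)
  case (monom c n)
  have "(\<integral>t. cmod (cconv (\<lambda>s. c * s powi n) (kern (\<lambda>k. (kap N k)\<^sup>2) N) t - c * t powi n) \<partial>circle_haar)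
      = cmod c * \<bar>(kap N (nat (int N + n)))\<^sup>2 - 1\<bar>" if N: "N \<ge> nat \<bar>n\<bar>" for N
  proof -
    \<comment> \<open>The slot of frequency \<open>n\<close>; it lies in \<open>{..2*N}\<close>
      because \<open>N\<close> is at least the absolute value of \<open>n\<close>.\<close>
    define m where "m = nat (int N + n)"
    have m: "m \<le> 2*N" "int m - int N = n" using N by (auto simp: m_def)
    have four: "fourier (\<lambda>s. c * s powi n) j = (if n = j then c else 0)" for j
      using fourier_powi[of n j]
      by (simp only: fourier_def mult.assoc integral_mult_right_zero) simp
    have "cconv (\<lambda>s. c * s powi n) (kern (\<lambda>k. (kap N k)\<^sup>2) N) t = of_real ((kap N m)\<^sup>2) * c * t powi n" for t
    proof -
      have "cconv (\<lambda>s. c * s powi n) (kern (\<lambda>k. (kap N k)\<^sup>2) N) t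
        = (\<Sum>k\<in>{m}. of_real ((kap N k)\<^sup>2) * c * t powi n)"
        unfolding cconv_kern[OF trig_integrable[OF trig.monom]] four
        using m by (intro sum.mono_neutral_cong_right) auto
      then show ?thesis by simp
    qed
    then have "cconv (\<lambda>s. c * s powi n) (kern (\<lambda>k. (kap N k)\<^sup>2) N) t - c * t powi n
        = of_real ((kap N m)\<^sup>2 - 1) * c * t powi n" for t
      by (simp only: of_real_diff left_diff_distrib of_real_1 mult_1_left)
    then have "(\<integral>t. cmod (cconv (\<lambda>s. c * s powi n) (kern (\<lambda>k. (kap N k)\<^sup>2) N) t - c * t powi n) \<partial>circle_haar)
      = (\<integral>t. cmod (of_real ((kap N m)\<^sup>2 - 1) * c * t powi n) \<partial>circle_haar)"
      by (simp only:)
    also have "\<dots> = (\<integral>t. cmod c * \<bar>(kap N m)\<^sup>2 - 1\<bar> \<partial>circle_haar)"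
    proof (rule integral_cong_AE)
      show "AE t in circle_haar. cmod (of_real ((kap N m)\<^sup>2 - 1) * c * t powi n) = cmod c * \<bar>(kap N m)\<^sup>2 - 1\<bar>"
        using AE_circle
        by eventually_elim (simp only: norm_mult norm_of_real norm_power_int power_int_1_left, simp)
    qed simp_all
    finally show ?thesis using circle.prob_space by (simp add: m_def)
  qed
  note norm_eq = this
  have "(\<lambda>N. cmod c * \<bar>(kap N (nat (int N + n)))\<^sup>2 - 1\<bar>) \<longlonglongrightarrow> cmod c * \<bar>1\<^sup>2 - 1\<bar>"
    by (intro tendsto_intros kap_tendsto)
  then have "(\<lambda>N. cmod c * \<bar>(kap N (nat (int N + n)))\<^sup>2 - 1\<bar>) \<longlonglongrightarrow> 0"
    by simp
  then show ?case
    by (rule Lim_transform_eventually)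
      (rule eventually_sequentiallyI[of "nat \<bar>n\<bar>"], rule norm_eq[symmetric])
next
  case (add f g)
  let ?J = "\<lambda>N. kern (\<lambda>k. (kap N k)\<^sup>2) N"
  have int: "integrable circle_haar f" "integrable circle_haar g" using add trig_integrable by auto
  have intJ: "integrable circle_haar (cconv f (?J N))" "integrable circle_haar (cconv g (?J N))" for N
    using int by (auto intro: trig_integrable trig_cconv_kern)
  have four: "fourier (\<lambda>s. f s + g s) j = fourier f j + fourier g j" for j
    using integrable_mult_powi[OF int(1)] integrable_mult_powi[OF int(2)]
    by (simp add: fourier_def distrib_right)
  have cadd: "cconv (\<lambda>s. f s + g s) (?J N) t = cconv f (?J N) t + cconv g (?J N) t" for N t
    using int by (simp add: cconv_kern four distrib_left distrib_right sum.distrib)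
  have "(\<integral>t. cmod (cconv (\<lambda>s. f s + g s) (?J N) t - (f t + g t)) \<partial>circle_haar)
     \<le> (\<integral>t. cmod (cconv f (?J N) t - f t) \<partial>circle_haar) + (\<integral>t. cmod (cconv g (?J N) t - g t) \<partial>circle_haar)" for N
  proof -
    have "(\<integral>t. cmod (cconv (\<lambda>s. f s + g s) (?J N) t - (f t + g t)) \<partial>circle_haar)
      \<le> (\<integral>t. cmod (cconv f (?J N) t - f t) + cmod (cconv g (?J N) t - g t) \<partial>circle_haar)"
      unfolding cadd using int intJ by (intro integral_mono norm_diff_triangle_ineq) auto
    also have "\<dots> = (\<integral>t. cmod (cconv f (?J N) t - f t) \<partial>circle_haar) + (\<integral>t. cmod (cconv g (?J N) t - g t) \<partial>circle_haar)"
      using int intJ by (intro Bochner_Integration.integral_add) auto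
    finally show ?thesis .
  qed
  moreover have "0 \<le> (\<integral>t. cmod (cconv (\<lambda>s. f s + g s) (?J N) t - (f t + g t)) \<partial>circle_haar)" for N
    by (intro Bochner_Integration.integral_nonneg) simp
  ultimately show ?case
    by (intro tendsto_sandwich[OF always_eventually always_eventually tendsto_const
          tendsto_add_zero[OF add.IH]] allI)
qed

text \<open>The contraction bound is uniform in \<open>N\<close>, so convergence passes from the
  dense trigonometric polynomials to all of L^1 by three errors of \<open>e/3\<close>.\<close>

lemma cconv_approx:
  assumes f: "integrable circle_haar f"
  shows "(\<lambda>N. \<integral>t. cmod (cconv f (kern (\<lambda>k. (kap N k)\<^sup>2) N) t - f t) \<partial>circle_haar) \<longlonglongrightarrow> 0"
proof (rule LIMSEQ_I)
  let ?J = "\<lambda>N. kern (\<lambda>k. (kap N k)\<^sup>2) N"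
  fix e :: real assume "e > 0"
  then obtain q where q: "trig q" "(\<integral>s. cmod (f s - q s) \<partial>circle_haar) < e/3"
    using trig_dense[OF f] unfolding trig_approx_def by (meson divide_pos_pos zero_less_numeral)
  have intq: "integrable circle_haar q" using q trig_integrable by blast
  have intJ: "integrable circle_haar (cconv f (?J N))" "integrable circle_haar (cconv q (?J N))" for N
    using f intq by (auto intro: trig_integrable trig_cconv_kern)
  have four: "fourier (\<lambda>s. f s - q s) j = fourier f j - fourier q j" for j
    using integrable_mult_powi[OF f] integrable_mult_powi[OF intq]
    by (simp add: fourier_def left_diff_distrib)
  have cdiff: "cconv f (?J N) t - cconv q (?J N) t = cconv (\<lambda>s. f s - q s) (?J N) t" for N t
    using f intq by (simp add: cconv_kern four left_diff_distrib right_diff_distrib sum_subtractf)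
  from q(1) have "eventually (\<lambda>N. (\<integral>t. cmod (cconv q (?J N) t - q t) \<partial>circle_haar) < e/3) sequentially"
    using \<open>e > 0\<close> by (intro order_tendstoD(2)[OF cconv_approx_trig]) auto
  then obtain M where M: "\<And>N. N \<ge> M \<Longrightarrow> (\<integral>t. cmod (cconv q (?J N) t - q t) \<partial>circle_haar) < e/3"
    unfolding eventually_sequentially by blast
  have "norm ((\<integral>t. cmod (cconv f (?J N) t - f t) \<partial>circle_haar) - 0) < e" if "N \<ge> M" for N
  proof -
    have "(\<integral>t. cmod (cconv f (?J N) t - cconv q (?J N) t) \<partial>circle_haar) \<le> (\<integral>s. cmod (f s - q s) \<partial>circle_haar)"
      unfolding cdiff using f intq
      by (intro cconv_kern_contract pos_kern_kap_square) (simp_all add: kap_centre)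
    moreover have "(\<integral>t. cmod (cconv f (?J N) t - f t) \<partial>circle_haar)
       \<le> (\<integral>t. cmod (cconv f (?J N) t - cconv q (?J N) t) \<partial>circle_haar) + (\<integral>t. cmod (cconv q (?J N) t - f t) \<partial>circle_haar)"
      by (intro integral_norm_triangle intJ f)
    moreover have "(\<integral>t. cmod (cconv q (?J N) t - f t) \<partial>circle_haar)
       \<le> (\<integral>t. cmod (cconv q (?J N) t - q t) \<partial>circle_haar) + (\<integral>t. cmod (q t - f t) \<partial>circle_haar)"
      by (intro integral_norm_triangle intJ f intq)
    moreover have "(\<integral>t. cmod (cconv f (?J N) t - f t) \<partial>circle_haar) \<ge> 0"
      by (intro Bochner_Integration.integral_nonneg) simp
    ultimately show ?thesis
      using M[OF that] q(2) by (simp add: norm_minus_commute)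
  qed
  then show "\<exists>M. \<forall>N\<ge>M. norm ((\<integral>t. cmod (cconv f (?J N) t - f t) \<partial>circle_haar) - 0) < e" by blast
qed

section \<open>Central functions on the group\<close>


lemma sets_haarG [measurable_cong]: "sets haarG = sets (borel \<Otimes>\<^sub>M count_space UNIV)"
  unfolding haarG_def by (intro sets_pair_measure_cong) (simp_all add: sign_haar_def)

lemma space_haarG [simp]: "space haarG = UNIV"
  by (simp add: haarG_def space_pair_measure sign_haar_def)

lemma sets_sign [simp]: "sets sign_haar = UNIV"
  by (simp add: sign_haar_def)

lemma prob_space_sign: "prob_space sign_haar"
  unfolding sign_haar_def by (rule prob_space_uniform_measure) simp_all

interpretation sgn: prob_space sign_haar
  by (rule prob_space_sign)

interpretation haar: pair_prob_space circle_haar sign_haar ..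

lemma prob_space_haarG: "prob_space haarG"
  unfolding haarG_def by unfold_locales

interpretation haarG: prob_space haarG
  by (rule prob_space_haarG)

text \<open>The second factor is countable and discrete, so measurability can be tested on each
  sheet.\<close>

lemma measurable_haarG_iff:
  "f \<in> haarG \<rightarrow>\<^sub>M N \<longleftrightarrow> (\<forall>b. (\<lambda>s. f (s, b)) \<in> borel \<rightarrow>\<^sub>M N)"
proof safe
  fix b assume [measurable]: "f \<in> haarG \<rightarrow>\<^sub>M N"
  show "(\<lambda>s. f (s, b)) \<in> borel \<rightarrow>\<^sub>M N" by measurable
next
  assume f: "\<forall>b. (\<lambda>s. f (s, b)) \<in> borel \<rightarrow>\<^sub>M N"
  have "(\<lambda>x. f (fst x, snd x)) \<in> borel \<Otimes>\<^sub>M count_space UNIV \<rightarrow>\<^sub>M N"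
    by (rule measurable_compose_countable) (use f in \<open>auto intro: measurable_compose[OF measurable_fst]\<close>)
  then show "f \<in> haarG \<rightarrow>\<^sub>M N"
    by (simp cong: measurable_cong_sets add: sets_haarG)
qed

lemma nn_integral_haarG:
  assumes [measurable]: "f \<in> borel_measurable haarG"
  shows "(\<integral>\<^sup>+x. f x \<partial>haarG)
    = ((\<integral>\<^sup>+s. f (s, 1) \<partial>circle_haar) + (\<integral>\<^sup>+s. f (s, -1) \<partial>circle_haar)) / 2"
proof -
  have sgn: "(\<integral>\<^sup>+b. g b \<partial>sign_haar) = (g 1 + g (-1)) / 2" for g :: "int \<Rightarrow> ennreal"
    unfolding sign_haar_def
    by (subst nn_integral_uniform_measure) (simp_all add: nn_integral_indicator_finite add.commute)
  have "(\<integral>\<^sup>+x. f x \<partial>haarG) = (\<integral>\<^sup>+b. (\<integral>\<^sup>+s. f (s, b) \<partial>circle_haar) \<partial>sign_haar)"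
    unfolding haarG_def by (rule haar.nn_integral_snd[symmetric]) (use assms in \<open>simp add: haarG_def\<close>)
  then show ?thesis by (simp add: sgn)
qed

lemma integrable_haarG_iff:
  fixes f :: "grp \<Rightarrow> 'a::{banach, second_countable_topology}"
  assumes [measurable]: "f \<in> borel_measurable haarG"
  shows "integrable haarG f \<longleftrightarrow>
    integrable circle_haar (\<lambda>s. f (s, 1)) \<and> integrable circle_haar (\<lambda>s. f (s, -1))"
  by (auto simp: integrable_iff_bounded nn_integral_haarG less_top[symmetric] ennreal_divide_eq_top_iff)

lemma integrable_haarG_sheet:
  fixes f :: "grp \<Rightarrow> 'a::{banach, second_countable_topology}"
  assumes "integrable haarG f" "b \<in> {1, -1}"
  shows "integrable circle_haar (\<lambda>s. f (s, b))"
  using assms integrable_haarG_iff[of f] by auto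

lemma integral_haarG:
  fixes f :: "grp \<Rightarrow> 'a::{banach, second_countable_topology}"
  assumes f: "integrable haarG f"
  shows "(\<integral>x. f x \<partial>haarG)
    = ((\<integral>s. f (s, 1) \<partial>circle_haar) + (\<integral>s. f (s, -1) \<partial>circle_haar)) /\<^sub>R 2"
proof -
  have sgn: "(\<integral>b. g b \<partial>sign_haar) = (g 1 + g (-1)) /\<^sub>R 2" for g :: "int \<Rightarrow> 'a"
  proof -
    have m: "measure sign_haar {b} = 1/2" if "b \<in> {1, -1}" for b
      using that unfolding sign_haar_def by (subst measure_uniform_measure) auto
    have "(\<integral>b. g b \<partial>sign_haar) = (\<integral>b. indicator {1} b *\<^sub>R g 1 + indicator {-1} b *\<^sub>R g (-1) \<partial>sign_haar)"
    proof (rule integral_cong_AE)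
      show "AE b in sign_haar. g b = indicator {1} b *\<^sub>R g 1 + indicator {-1} b *\<^sub>R g (-1)"
        unfolding sign_haar_def by (rule AE_uniform_measureI) (auto simp: indicator_def)
    qed (simp_all add: sign_haar_def)
    also have "\<dots> = measure sign_haar {1} *\<^sub>R g 1 + measure sign_haar {-1} *\<^sub>R g (-1)"
      by (intro has_bochner_integral_integral_eq has_bochner_integral_add has_bochner_integral_indicator)
        (simp_all add: less_top[symmetric])
    also have "\<dots> = (g 1 + g (-1)) /\<^sub>R 2"
      by (simp add: m scaleR_add_right)
    finally show ?thesis .
  qed
  have "(\<integral>x. f x \<partial>haarG) = (\<integral>b. (\<integral>s. f (s, b) \<partial>circle_haar) \<partial>sign_haar)"
    unfolding haarG_def
    by (subst haar.integral_snd[of "\<lambda>s b. f (s, b)"]) (use f in \<open>simp_all add: haarG_def\<close>)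
  then show ?thesis by (simp add: sgn)
qed

lemma sets_sheet:
  assumes "A \<in> sets haarG"
  shows "{s. (s, b) \<in> A} \<in> sets borel"
proof -
  have "(\<lambda>s. (s, b)) -` A \<inter> space borel \<in> sets borel"
    by (rule measurable_sets[OF _ assms]) measurable
  then show ?thesis by (simp add: vimage_def)
qed

lemma emeasure_haarG:
  assumes [measurable]: "A \<in> sets haarG"
  shows "emeasure haarG A
    = (emeasure circle_haar {s. (s, 1) \<in> A} + emeasure circle_haar {s. (s, -1) \<in> A}) / 2"
proof -
  note sec = sets_sheet[OF assms]
  have "emeasure haarG A = (\<integral>\<^sup>+x. indicator A x \<partial>haarG)" by simp
  also have "\<dots> = ((\<integral>\<^sup>+s. indicator {s. (s, 1) \<in> A} s \<partial>circle_haar)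
      + (\<integral>\<^sup>+s. indicator {s. (s, -1) \<in> A} s \<partial>circle_haar)) / 2"
  proof -
    have "indicator A (s, b) = (indicator {s. (s, b) \<in> A} s :: ennreal)" for s b
      by (simp add: indicator_def)
    then show ?thesis by (subst nn_integral_haarG) (use assms in simp_all)
  qed
  finally have "emeasure haarG A = ((\<integral>\<^sup>+s. indicator {s. (s, 1) \<in> A} s \<partial>circle_haar)
      + (\<integral>\<^sup>+s. indicator {s. (s, -1) \<in> A} s \<partial>circle_haar)) / 2" .
  moreover have "(\<integral>\<^sup>+s. indicator {s. (s, b) \<in> A} s \<partial>circle_haar) = emeasure circle_haar {s. (s, b) \<in> A}" for b
    by (rule nn_integral_indicator) (simp add: sec)
  ultimately show ?thesis by (simp only:)
qed

text \<open>\<open>P\<close> carries no measurability assumption, so both directions go through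
  measurable null sets containing the exceptional points.\<close>

lemma AE_haarG_iff:
  "(AE x in haarG. P x) \<longleftrightarrow> (AE s in circle_haar. P (s, 1)) \<and> (AE s in circle_haar. P (s, -1))"
proof safe
  assume "AE x in haarG. P x"
  then obtain N where N: "{x. \<not> P x} \<subseteq> N" "emeasure haarG N = 0" "N \<in> sets haarG"
    by (rule AE_E) simp
  note sec = sets_sheet[OF N(3)]
  have null: "emeasure circle_haar {s. (s, 1) \<in> N} = 0" "emeasure circle_haar {s. (s, -1) \<in> N} = 0"
    using N(2,3) by (simp_all add: emeasure_haarG)
  show "AE s in circle_haar. P (s, 1)"
    by (rule AE_I[OF _ null(1)]) (use N(1) sec in auto)
  show "AE s in circle_haar. P (s, -1)"
    by (rule AE_I[OF _ null(2)]) (use N(1) sec in auto)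
next
  assume "AE s in circle_haar. P (s, 1)" "AE s in circle_haar. P (s, -1)"
  then obtain A B where A: "{s. \<not> P (s, 1)} \<subseteq> A" "emeasure circle_haar A = 0" "A \<in> sets borel"
    and B: "{s. \<not> P (s, -1)} \<subseteq> B" "emeasure circle_haar B = 0" "B \<in> sets borel"
    by (elim AE_E) auto
  \<comment> \<open>Points whose second coordinate is not a sign exist in the type but carry no
    mass; all of them are put into the null set.\<close>
  define N where "N = A \<times> {1::int} \<union> B \<times> {-1} \<union> UNIV \<times> (- {1, -1})"
  have N: "N \<in> sets haarG"
    unfolding N_def sets_haarG using A B by (intro sets.Un pair_measureI) auto
  have sec: "{s. (s, 1) \<in> N} = A" "{s. (s, -1) \<in> N} = B" by (auto simp: N_def)
  show "AE x in haarG. P x"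
  proof (rule AE_I)
    show "emeasure haarG N = 0" using N A B by (simp add: emeasure_haarG sec)
    show "{x \<in> space haarG. \<not> P x} \<subseteq> N"
      using A(1) B(1) by (auto simp: N_def)
  qed (fact N)
qed

section \<open>Invariance of the circle measure and convolution on the two components\<close>

lemma integral_sub_left:
  fixes F :: "complex \<Rightarrow> 'a::{banach, second_countable_topology}"
  assumes "F \<in> borel_measurable borel" "cmod t = 1"
  shows "(\<integral>s. F (inverse s * t) \<partial>circle_haar) = (\<integral>s. F s \<partial>circle_haar)"
  using integral_distr[of "\<lambda>s. inverse s * t" circle_haar borel F] assms
  by (simp add: distr_circle_left)

lemma integral_sub_right:
  fixes F :: "complex \<Rightarrow> 'a::{banach, second_countable_topology}"
  assumes "F \<in> borel_measurable borel" "cmod t = 1"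
  shows "(\<integral>s. F (s * t) \<partial>circle_haar) = (\<integral>s. F s \<partial>circle_haar)"
  using integral_distr[of "\<lambda>s. s * t" circle_haar borel F] assms
  by (simp add: distr_circle_right)

lemma integrable_sub_left:
  fixes F :: "complex \<Rightarrow> 'a::{banach, second_countable_topology}"
  assumes "integrable circle_haar F" "cmod t = 1"
  shows "integrable circle_haar (\<lambda>s. F (inverse s * t))"
  by (rule integrable_distr[of _ _ borel]) (use assms in \<open>simp_all add: distr_circle_left\<close>)

lemma integrable_sub_right:
  fixes F :: "complex \<Rightarrow> 'a::{banach, second_countable_topology}"
  assumes "integrable circle_haar F" "cmod t = 1"
  shows "integrable circle_haar (\<lambda>s. F (s * t))"
  by (rule integrable_distr[of _ _ borel]) (use assms in \<open>simp_all add: distr_circle_right\<close>)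

lemma AE_sub_left:
  assumes "AE s in circle_haar. P s" "cmod t = 1"
  shows "AE s in circle_haar. P (inverse s * t)"
proof -
  have "AE s in distr circle_haar borel (\<lambda>s. inverse s * t). P s"
    unfolding distr_circle_left[OF assms(2)] by (rule assms(1))
  then show ?thesis by (rule AE_distrD[rotated]) simp
qed

lemma AE_sub_right:
  assumes "AE s in circle_haar. P s" "cmod t = 1"
  shows "AE s in circle_haar. P (s * t)"
proof -
  have "AE s in distr circle_haar borel (\<lambda>s. s * t). P s"
    unfolding distr_circle_right[OF assms(2)] by (rule assms(1))
  then show ?thesis by (rule AE_distrD[rotated]) simp
qed

lemma measurable_sheet [measurable (raw)]:
  assumes "f \<in> haarG \<rightarrow>\<^sub>M N" "h \<in> M \<rightarrow>\<^sub>M borel"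
  shows "(\<lambda>s. f (h s, b)) \<in> M \<rightarrow>\<^sub>M N"
  using assms(1) unfolding measurable_haarG_iff by (auto intro: measurable_compose[OF assms(2)])

lemma gmult_ginv: "gmult (ginv (s, a)) (t, b) = (s powi (- a) * t powi a, a * b)"
  by (simp add: gmult_def ginv_def)

lemma conv_integrand_measurable:
  fixes f g :: fn
  assumes [measurable]: "f \<in> borel_measurable haarG" "g \<in> borel_measurable haarG"
  shows "(\<lambda>y. f y * g (gmult (ginv y) x)) \<in> borel_measurable haarG"
proof -
  obtain t b where x: "x = (t, b)" by force
  show ?thesis
    unfolding measurable_haarG_iff x gmult_ginv
    by (intro allI borel_measurable_times measurable_sheet[OF assms(1)] measurable_sheet[OF assms(2)]
        powi_measurable) simp_all
qed

text \<open>A rotation \<open>(s, 1)\<close> has inverse \<open>(inverse s, 1)\<close>, while a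
  reflection \<open>(s, -1)\<close> is its own inverse, and multiplying by it inverts
  \<open>t\<close> and flips the sign of \<open>b\<close>.\<close>

lemma conv_sheets:
  assumes [measurable]: "f \<in> borel_measurable haarG" "g \<in> borel_measurable haarG"
    and "integrable circle_haar (\<lambda>s. f (s, 1) * g (inverse s * t, b))"
    and "integrable circle_haar (\<lambda>s. f (s, -1) * g (s * inverse t, - b))"
  shows "conv f g (t, b) = ((\<integral>s. f (s, 1) * g (inverse s * t, b) \<partial>circle_haar)
     + (\<integral>s. f (s, -1) * g (s * inverse t, - b) \<partial>circle_haar)) / 2"
proof -
  have "integrable haarG (\<lambda>y. f y * g (gmult (ginv y) (t, b)))"
    using assms(3,4)
    by (subst integrable_haarG_iff[OF conv_integrand_measurable[OF assms(1,2)]])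
      (simp add: gmult_ginv power_int_minus)
  from integral_haarG[OF this] show ?thesis
    by (simp add: conv_def gmult_ginv power_int_minus scaleR_conv_of_real)
qed

lemma conv_measurable:
  assumes [measurable]: "f \<in> borel_measurable haarG" "g \<in> borel_measurable haarG"
  shows "conv f g \<in> borel_measurable haarG"
  unfolding measurable_haarG_iff
proof
  fix b
  have "(\<lambda>x :: complex \<times> grp. f (fst (snd x), snd (snd x)) *
      g (fst (snd x) powi (- snd (snd x)) * fst x powi (snd (snd x)), snd (snd x) * b))
    \<in> borel_measurable (borel \<Otimes>\<^sub>M haarG)"
  proof (rule measurable_compose_countable[where g = "\<lambda>x. snd (snd x)" and
        f = "\<lambda>a x. f (fst (snd x), a) * g (fst (snd x) powi (- a) * fst x powi a, a * b)"])
    show "(\<lambda>x :: complex \<times> grp. snd (snd x)) \<in> borel \<Otimes>\<^sub>M haarG \<rightarrow>\<^sub>M count_space UNIV"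
      by measurable
    show "(\<lambda>x :: complex \<times> grp. f (fst (snd x), a) * g (fst (snd x) powi (- a) * fst x powi a, a * b))
      \<in> borel_measurable (borel \<Otimes>\<^sub>M haarG)" for a
      by (intro borel_measurable_times measurable_sheet[OF assms(1)] measurable_sheet[OF assms(2)]
        powi_measurable) measurable
  qed
  then have "(\<lambda>(t, y). f y * g (gmult (ginv y) (t, b))) \<in> borel_measurable (borel \<Otimes>\<^sub>M haarG)"
    by (simp add: case_prod_unfold gmult_def ginv_def)
  then show "(\<lambda>t. conv f g (t, b)) \<in> borel_measurable borel"
    unfolding conv_def by (rule haarG.borel_measurable_lebesgue_integral)
qed

lemma ZL1_integrable: "f \<in> ZL1 \<Longrightarrow> integrable haarG f"
  by (simp add: ZL1_def)

lemma ZL1_measurable: "f \<in> ZL1 \<Longrightarrow> f \<in> borel_measurable haarG"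
  by (rule borel_measurable_integrable[OF ZL1_integrable])

lemma ZL1_commute: "f \<in> ZL1 \<Longrightarrow> integrable haarG g \<Longrightarrow> AE x in haarG. conv f g x = conv g f x"
  by (simp add: ZL1_def)

lemma conv_scale_left: "conv (\<lambda>x. c * f x) g = (\<lambda>x. c * conv f g x)"
  by (simp add: conv_def mult.assoc)

lemma conv_scale_right: "conv f (\<lambda>x. c * g x) = (\<lambda>x. c * conv f g x)"
proof
  fix x
  have "f y * (c * g z) = c * (f y * g z)" for y z by simp
  then show "conv f (\<lambda>x. c * g x) x = c * conv f g x"
    unfolding conv_def by (simp only: integral_mult_right_zero)
qed

lemma ZL1_scale:
  assumes f: "f \<in> ZL1"
  shows "(\<lambda>x. c * f x) \<in> ZL1"
  unfolding ZL1_def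
proof (intro CollectI conjI allI impI)
  show "integrable haarG (\<lambda>x. c * f x)" using ZL1_integrable[OF f] by simp
  fix g :: fn assume "integrable haarG g"
  from ZL1_commute[OF f this] show "AE x in haarG. conv (\<lambda>x. c * f x) g x = conv g (\<lambda>x. c * f x) x"
    unfolding conv_scale_left conv_scale_right by eventually_elim simp
qed

text \<open>A null change of the left factor leaves the convolution unchanged at every point. For
  the right factor one needs that \<open>y -> gmult (ginv y) x\<close> preserves null sets, which is
  shown for \<open>x\<close> in the group and hence gives equality almost everywhere.\<close>

lemma ZL1_cong_AE:
  assumes f: "f \<in> ZL1" and [measurable]: "g \<in> borel_measurable haarG"
    and eq: "AE x in haarG. f x = g x"
  shows "g \<in> ZL1"
  unfolding ZL1_def
proof (intro CollectI conjI allI impI)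
  note [measurable] = ZL1_measurable[OF f]
  show "integrable haarG g"
    by (rule integrable_cong_AE_imp[OF ZL1_integrable[OF f] _ eq]) simp
  fix h :: fn assume h: "integrable haarG h"
  then have [measurable]: "h \<in> borel_measurable haarG" by simp
  have left: "conv g h x = conv f h x" for x
    unfolding conv_def
  proof (rule integral_cong_AE)
    show "AE y in haarG. g y * h (gmult (ginv y) x) = f y * h (gmult (ginv y) x)"
      using eq by eventually_elim simp
  qed (rule conv_integrand_measurable; measurable)+
  have eq': "AE s in circle_haar. f (s, c) = g (s, c)" if "c \<in> {1, -1}" for c
    using eq that by (auto simp: AE_haarG_iff)
  have right: "conv h g (t, b) = conv h f (t, b)" if t: "cmod t = 1" and b: "b \<in> {1, -1}" for t b
    unfolding conv_def
  proof (rule integral_cong_AE)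
    have "cmod (inverse t) = 1" using t by (simp add: norm_inverse)
    moreover have "- b \<in> {1, -1}" using b by auto
    ultimately have "AE s in circle_haar. f (inverse s * t, b) = g (inverse s * t, b)"
        "AE s in circle_haar. f (s * inverse t, - b) = g (s * inverse t, - b)"
      by (intro AE_sub_left[OF eq'[OF b] t] AE_sub_right[OF eq'])+
    then have "AE s in circle_haar. h (s, 1) * g (gmult (ginv (s, 1)) (t, b))
          = h (s, 1) * f (gmult (ginv (s, 1)) (t, b))"
        "AE s in circle_haar. h (s, -1) * g (gmult (ginv (s, -1)) (t, b))
          = h (s, -1) * f (gmult (ginv (s, -1)) (t, b))"
      by (eventually_elim, simp add: gmult_ginv power_int_minus)+
    then show "AE y in haarG. h y * g (gmult (ginv y) (t, b)) = h y * f (gmult (ginv y) (t, b))"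
      by (simp only: AE_haarG_iff)
  qed (rule conv_integrand_measurable; measurable)+
  have "AE x in haarG. conv h g x = conv h f x"
    unfolding AE_haarG_iff by (intro conjI; rule AE_mp[OF AE_circle]; intro AE_I2 impI right; simp)
  then show "AE x in haarG. conv g h x = conv h g x"
    using ZL1_commute[OF f h] by eventually_elim (simp add: left)
qed

section \<open>Class functions and their centrality\<close>

text \<open>All reflections of the group are conjugate, so a class function is constant on them. The
  value 0 off the carrier lets later identities hold as equalities of functions.\<close>

definition cls :: "(complex \<Rightarrow> complex) \<Rightarrow> complex \<Rightarrow> fn" where
  "cls p c = (\<lambda>(s, b). if b = 1 then p s else if b = -1 then c else 0)"

lemma cls_simps [simp]: "cls p c (s, 1) = p s" "cls p c (s, -1) = c"
  by (simp_all add: cls_def)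

lemma cls_measurable [measurable]:
  assumes [measurable]: "p \<in> borel_measurable borel"
  shows "cls p c \<in> borel_measurable haarG"
  unfolding measurable_haarG_iff cls_def by simp

lemma cls_integrable:
  assumes "trig p"
  shows "integrable haarG (cls p c)"
  using assms trig_integrable[OF assms] trig_measurable[OF assms]
  by (subst integrable_haarG_iff) simp_all

text \<open>The substitution \<open>s -> inverse s * t\<close> is a measure-preserving involution of
  the circle and exchanges the two integrands; boundedness of \<open>p\<close> supplies
  integrability.\<close>

lemma trig_swap:
  assumes p: "trig p" and F: "integrable circle_haar F" and t: "cmod t = 1"
  shows "integrable circle_haar (\<lambda>s. F s * p (inverse s * t))"
    and "integrable circle_haar (\<lambda>s. p s * F (inverse s * t))"
    and "(\<integral>s. p s * F (inverse s * t) \<partial>circle_haar) = (\<integral>s. F s * p (inverse s * t) \<partial>circle_haar)"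
proof -
  have [measurable]: "p \<in> borel_measurable borel" by (rule trig_measurable[OF p])
  note [measurable] = borel_measurable_integrable[OF F]
  obtain B where B: "\<And>s. cmod s = 1 \<Longrightarrow> cmod (p s) \<le> B"
    using trig_bounded[OF p] by blast
  have "cmod (p (inverse s * t)) \<le> B" if "cmod s = 1" for s
    using that t by (intro B) (simp add: norm_mult norm_inverse)
  then show 1: "integrable circle_haar (\<lambda>s. F s * p (inverse s * t))"
    by (intro integrable_mult_bounded[OF F, of _ B]) simp_all
  have eq: "AE s in circle_haar. F (inverse s * t) * p (inverse (inverse s * t) * t) = p s * F (inverse s * t)"
    using AE_circle
  proof eventually_elim
    case (elim s)
    then have "s \<noteq> 0" "t \<noteq> 0" using t by auto
    then have "inverse (inverse s * t) * t = s" by simp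
    then show ?case by (simp only: mult.commute)
  qed
  show "integrable circle_haar (\<lambda>s. p s * F (inverse s * t))"
    by (rule integrable_cong_AE_imp[OF integrable_sub_left[OF 1 t] _ eq]) simp
  have "(\<integral>s. p s * F (inverse s * t) \<partial>circle_haar)
    = (\<integral>s. F (inverse s * t) * p (inverse (inverse s * t) * t) \<partial>circle_haar)"
    using eq[THEN AE_symmetric] by (intro integral_cong_AE) simp_all
  also have "\<dots> = (\<integral>s. F s * p (inverse s * t) \<partial>circle_haar)"
    by (rule integral_sub_left) (simp_all add: t)
  finally show "(\<integral>s. p s * F (inverse s * t) \<partial>circle_haar) = (\<integral>s. F s * p (inverse s * t) \<partial>circle_haar)" .
qed

text \<open>The constant \<open>c\<close> meets \<open>g\<close> only through its mean, which is
  translation invariant. The \<open>p\<close> terms agree by commutativity of the circle, once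
  evenness has turned \<open>p (s * inverse t)\<close> into \<open>p (inverse s * t)\<close> on the
  reflections.\<close>

lemma cls_ZL1:
  assumes p: "trig p" and even: "\<And>s. cmod s = 1 \<Longrightarrow> p (inverse s) = p s"
  shows "cls p c \<in> ZL1"
  unfolding ZL1_def
proof (intro CollectI conjI allI impI)
  have [measurable]: "p \<in> borel_measurable borel" by (rule trig_measurable[OF p])
  show "integrable haarG (cls p c)" by (rule cls_integrable[OF p])
  fix g :: fn assume g: "integrable haarG g"
  then have [measurable]: "g \<in> borel_measurable haarG" by simp
  have g_int: "integrable circle_haar (\<lambda>s. g (s, 1))" "integrable circle_haar (\<lambda>s. g (s, -1))"
    using g integrable_haarG_sheet by auto
  have commute: "conv (cls p c) g (t, b) = conv g (cls p c) (t, b)"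
    if t: "cmod t = 1" and b: "b \<in> {1, -1}" for t b
  proof -
    have t': "cmod (inverse t) = 1" using t by (simp add: norm_inverse)
    have shift: "p (s * inverse t) = p (inverse s * t)" if "cmod s = 1" for s
      using even[of "s * inverse t"] that t by (simp add: norm_mult norm_inverse)
    note p_int = trig_swap(1,2)[OF p _ t] and p_eq = trig_swap(3)[OF p _ t]
    have p_shift: "integrable circle_haar (\<lambda>s. F s * p (s * inverse t))"
        "(\<integral>s. F s * p (s * inverse t) \<partial>circle_haar) = (\<integral>s. F s * p (inverse s * t) \<partial>circle_haar)"
      if F: "integrable circle_haar F" for F
    proof -
      note [measurable] = borel_measurable_integrable[OF F]
      have eq: "AE s in circle_haar. F s * p (inverse s * t) = F s * p (s * inverse t)"
        using AE_circle by eventually_elim (simp only: shift)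
      show "integrable circle_haar (\<lambda>s. F s * p (s * inverse t))"
        by (rule integrable_cong_AE_imp[OF p_int(1)[OF F] _ eq]) simp
      show "(\<integral>s. F s * p (s * inverse t) \<partial>circle_haar) = (\<integral>s. F s * p (inverse s * t) \<partial>circle_haar)"
        using eq[THEN AE_symmetric] by (intro integral_cong_AE) simp_all
    qed
    show ?thesis
    proof (cases "b = 1")
      case True
      show ?thesis
        using g_int p_int[OF g_int(1)] p_eq[OF g_int(1)]
          integrable_sub_right[OF g_int(2) t'] integral_sub_right[OF _ t', of "\<lambda>s. g (s, -1)"]
        by (subst (1 2) conv_sheets) (simp_all add: True mult.commute[of c])
    next
      case False
      then have b: "b = -1" using b by simp
      show ?thesis
        using g_int p_int[OF g_int(2)] p_eq[OF g_int(2)] p_shift[OF g_int(2)]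
          integrable_sub_right[OF g_int(1) t'] integral_sub_right[OF _ t', of "\<lambda>s. g (s, 1)"]
        by (subst (1 2) conv_sheets) (simp_all add: b mult.commute[of c])
    qed
  qed
  show "AE x in haarG. conv (cls p c) g x = conv g (cls p c) x"
    unfolding AE_haarG_iff by (intro conjI; rule AE_mp[OF AE_circle]; intro AE_I2 impI commute; simp)
qed

section \<open>Eigenfunctions of convolution by central functions\<close>


abbreviation sheet :: "fn \<Rightarrow> int \<Rightarrow> complex \<Rightarrow> complex" where
  "sheet f b \<equiv> (\<lambda>s. f (s, b))"

text \<open>For nonzero \<open>m\<close> this is half a minimal idempotent. All integers are
  allowed, with \<open>E (- m) = E m\<close>, so that kernels can be summed over symmetric
  frequencies; \<open>E 0\<close> equals \<open>chi 1 + chi (-1)\<close> and is an idempotent that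
  is not minimal.\<close>

definition E :: "int \<Rightarrow> fn" where
  "E m = cls (\<lambda>s. s powi m + s powi (- m)) 0"

definition chi :: "complex \<Rightarrow> fn" where
  "chi c = cls (\<lambda>_. 1) c"

lemma trig_const: "trig (\<lambda>_. c)"
  using trig.monom[of c 0] by simp

lemma trig_powi: "trig (\<lambda>s. s powi m)"
  using trig.monom[of 1 m] by simp

lemma E_ZL1: "E m \<in> ZL1"
  unfolding E_def
  by (intro cls_ZL1 trig.add trig_powi) (simp add: power_int_minus power_int_inverse)

lemma chi_ZL1: "chi c \<in> ZL1"
  unfolding chi_def by (intro cls_ZL1 trig_const) simp

text \<open>If \<open>i * b\<close> is a sign then \<open>b\<close> is a unit of the integers, hence
  a sign; so off the carrier the right factor is only ever evaluated where it vanishes.\<close>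

lemma conv_off_carrier:
  assumes "b \<notin> {1, -1}"
  shows "conv a (cls p c) (t, b) = 0"
proof -
  have "i * b \<noteq> 1" "i * b \<noteq> -1" for i
    using assms zmult_eq_1_iff[of i b] zmult_eq_1_iff[of "- i" b] by auto
  then have "cls p c (gmult (ginv (s, i)) (t, b)) = 0" for s i
    by (simp add: gmult_ginv cls_def)
  then have zero: "a y * cls p c (gmult (ginv y) (t, b)) = 0" for y
    by (cases y) simp
  show ?thesis unfolding conv_def zero by simp
qed

lemma conv_E:
  assumes a: "integrable haarG a"
  shows "conv a (E m) (t, 1) = (t powi m * fourier (sheet a 1) m + t powi (- m) * fourier (sheet a 1) (- m)) / 2"
    and "conv a (E m) (t, -1) = (t powi m * fourier (sheet a (-1)) m + t powi (- m) * fourier (sheet a (-1)) (- m)) / 2"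
proof -
  have int: "integrable circle_haar (\<lambda>s. a (s, b) * s powi n)" if "b \<in> {1, -1}" for b n
    by (intro integrable_mult_powi integrable_haarG_sheet[OF a that])
  have 1: "a (s, b) * E m (inverse s * t, 1)
      = t powi m * (a (s, b) * s powi (- m)) + t powi (- m) * (a (s, b) * s powi m)" for s b
    by (simp add: E_def power_int_mult_distrib power_int_minus power_int_inverse algebra_simps)
  have 2: "a (s, b) * E m (s * inverse t, 1)
      = t powi m * (a (s, b) * s powi (- m)) + t powi (- m) * (a (s, b) * s powi m)" for s b
    by (simp add: E_def power_int_mult_distrib power_int_minus power_int_inverse algebra_simps)
  have 0: "E m (s, -1) = 0" for s by (simp add: E_def)
  have meas: "a \<in> borel_measurable haarG" "E m \<in> borel_measurable haarG"
    using a ZL1_measurable[OF E_ZL1] by auto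
  show "conv a (E m) (t, 1) = (t powi m * fourier (sheet a 1) m + t powi (- m) * fourier (sheet a 1) (- m)) / 2"
    using int by (subst conv_sheets[OF meas]) (simp_all add: 0 1 fourier_def)
  show "conv a (E m) (t, -1) = (t powi m * fourier (sheet a (-1)) m + t powi (- m) * fourier (sheet a (-1)) (- m)) / 2"
    using int by (subst conv_sheets[OF meas]) (simp_all add: 0 2 fourier_def)
qed

definition refl_powi :: "int \<Rightarrow> fn" where
  "refl_powi m = (\<lambda>(s, b). if b = -1 then s powi m else 0)"

lemma refl_powi_integrable: "integrable haarG (refl_powi m)"
proof -
  have [measurable]: "refl_powi m \<in> borel_measurable haarG"
    unfolding measurable_haarG_iff refl_powi_def by simp
  show ?thesis by (subst integrable_haarG_iff) (simp_all add: refl_powi_def)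
qed

text \<open>Obtained by commuting with \<open>s ^ m\<close> supported on either of the two components.\<close>

lemma ZL1_fourier:
  assumes a: "a \<in> ZL1"
  shows "fourier (sheet a 1) (- m) = fourier (sheet a 1) m"
    and "m \<noteq> 0 \<Longrightarrow> fourier (sheet a (-1)) m = 0"
proof -
  have ai: "integrable haarG a" by (rule ZL1_integrable[OF a])
  have int: "integrable circle_haar (sheet a 1)" "integrable circle_haar (sheet a (-1))"
    using integrable_haarG_sheet[OF ai] by simp_all
  have meas [measurable]: "a \<in> borel_measurable haarG" using ai by simp
  let ?e = "cls (\<lambda>s. s powi m) 0" and ?o = "refl_powi m"
  have eo: "?e \<in> borel_measurable haarG" "?o \<in> borel_measurable haarG"
    using refl_powi_integrable by auto
  have dist: "z * (inverse s * t) powi m = t powi m * (z * s powi (- m))"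
      "z * (s * inverse t) powi m = t powi (- m) * (z * s powi m)" for z s t :: complex
    by (simp_all add: power_int_mult_distrib power_int_minus power_int_inverse)
  have ea: "conv ?e a (t, -1) = t powi m * fourier (sheet a (-1)) m / 2" if t: "cmod t = 1" for t
    using trig_swap[OF trig_powi int(2) t, of m]
    by (subst conv_sheets[OF eo(1) meas]) (simp_all add: dist fourier_def)
  have ae: "conv a ?e (t, -1) = t powi (- m) * fourier (sheet a (-1)) (- m) / 2" for t
    using integrable_mult_powi[OF int(2), of m]
    by (subst conv_sheets[OF meas eo(1)]) (simp_all add: dist fourier_def)
  have oa: "conv ?o a (t, -1) = t powi m * fourier (sheet a 1) (- m) / 2" if t: "cmod t = 1" for t
  proof -
    have t0: "t \<noteq> 0" "cmod (inverse t) = 1" using t by (auto simp: norm_inverse)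
    \<comment> \<open>Its shift by \<open>inverse t\<close> is the integrand of
      \<open>conv ?o a\<close> over the reflections.\<close>
    let ?F = "\<lambda>s. t powi m * (a (s, 1) * s powi m)"
    have F: "integrable circle_haar ?F" using integrable_mult_powi[OF int(1)] by simp
    have eq: "?F (s * inverse t) = s powi m * a (s * inverse t, 1)" for s
      using t0 by (simp add: power_int_mult_distrib power_int_inverse)
    show ?thesis
      using integrable_sub_right[OF F t0(2)] integral_sub_right[OF borel_measurable_integrable[OF F, unfolded measurable_cong_sets[OF sets_circle refl]] t0(2)]
      unfolding eq
      by (subst conv_sheets[OF eo(2) meas]) (simp_all add: refl_powi_def fourier_def)
  qed
  have ao: "conv a ?o (t, -1) = t powi m * fourier (sheet a 1) m / 2" for t
    using integrable_mult_powi[OF int(1), of "- m"]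
    by (subst conv_sheets[OF meas eo(2)]) (simp_all add: dist refl_powi_def fourier_def)
  have "AE t in circle_haar. conv a ?o (t, -1) = conv ?o a (t, -1)"
    using ZL1_commute[OF a refl_powi_integrable] by (simp add: AE_haarG_iff)
  then have "AE t in circle_haar. fourier (sheet a 1) (- m) = fourier (sheet a 1) m"
    using AE_circle
  proof eventually_elim
    case (elim t)
    then have "t \<noteq> 0" by auto
    then show ?case using elim by (simp add: ao oa)
  qed
  then show "fourier (sheet a 1) (- m) = fourier (sheet a 1) m" by simp
  assume m: "m \<noteq> 0"
  have "AE t in circle_haar. conv a ?e (t, -1) = conv ?e a (t, -1)"
    using ZL1_commute[OF a cls_integrable[OF trig_powi]] by (simp add: AE_haarG_iff)
  then have "AE t in circle_haar. fourier (sheet a (-1)) m = fourier (sheet a (-1)) (- m) * t powi (- 2 * m)"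
    using AE_circle
  proof eventually_elim
    case (elim t)
    then have t: "t \<noteq> 0" by auto
    have "t powi (- 2 * m) = t powi (- m) * t powi (- m)"
      using t by (simp flip: power_int_add)
    then show ?case using elim t by (simp add: ea ae power_int_minus field_simps)
  qed
  \<comment> \<open>Averaging over \<open>t\<close> keeps the constant on the left and kills the
    nonzero frequency \<open>- 2 * m\<close> on the right.\<close>
  then have "(\<integral>t. fourier (sheet a (-1)) m \<partial>circle_haar)
      = (\<integral>t. fourier (sheet a (-1)) (- m) * t powi (- 2 * m) \<partial>circle_haar)"
    by (intro integral_cong_AE) simp_all
  then show "fourier (sheet a (-1)) m = 0"
    using m circle.prob_space by (simp add: integral_circle_powi)
qed

text \<open>Symmetric coefficients reassemble \<open>E m\<close> on the rotations, and vanishing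
  ones give 0 on the reflections. At \<open>m = 0\<close> this breaks down, since \<open>a\<close>
  may have nonzero mean over the reflections; there the two characters take over.\<close>

lemma conv_E_eigen:
  assumes a: "a \<in> ZL1" and m: "m \<noteq> 0"
  shows "conv a (E m) = (\<lambda>x. fourier (sheet a 1) m / 2 * E m x)"
proof
  fix x :: grp
  obtain t b where x: "x = (t, b)" by force
  consider "b = 1" | "b = -1" | "b \<notin> {1, -1}" by auto
  then show "conv a (E m) x = fourier (sheet a 1) m / 2 * E m x"
  proof cases
    case 1
    then show ?thesis using ZL1_fourier(1)[OF a, of m]
      by (simp add: x conv_E[OF ZL1_integrable[OF a]]) (simp add: E_def algebra_simps)
  next
    case 2
    then show ?thesis using ZL1_fourier(2)[OF a, of m] ZL1_fourier(2)[OF a, of "- m"] m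
      by (simp add: x conv_E[OF ZL1_integrable[OF a]]) (simp add: E_def)
  next
    case 3
    then show ?thesis by (simp add: x E_def conv_off_carrier) (simp add: cls_def)
  qed
qed

lemma conv_chi_eigen:
  assumes a: "integrable haarG a" and c: "c\<^sup>2 = 1"
  shows "conv a (chi c) = (\<lambda>x. (fourier (sheet a 1) 0 + c * fourier (sheet a (-1)) 0) / 2 * chi c x)"
proof
  fix x :: grp
  obtain t b where x: "x = (t, b)" by force
  have int: "integrable circle_haar (sheet a 1)" "integrable circle_haar (sheet a (-1))"
    using integrable_haarG_sheet[OF a] by simp_all
  have meas: "a \<in> borel_measurable haarG" "chi c \<in> borel_measurable haarG"
    using a ZL1_measurable[OF chi_ZL1] by auto
  have c': "c * (c * z) = z" for z
    using c by (simp add: power2_eq_square flip: mult.assoc)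
  consider "b = 1" | "b = -1" | "b \<notin> {1, -1}" by auto
  then show "conv a (chi c) x = (fourier (sheet a 1) 0 + c * fourier (sheet a (-1)) 0) / 2 * chi c x"
  proof cases
    case 1
    then show ?thesis using int
      by (simp add: x) (subst conv_sheets[OF meas]; simp add: chi_def fourier_def mult.commute)
  next
    case 2
    then show ?thesis using int
      by (simp add: x) (subst conv_sheets[OF meas]; simp add: chi_def fourier_def c' algebra_simps)
  next
    case 3
    then show ?thesis by (simp add: x chi_def conv_off_carrier) (simp add: cls_def)
  qed
qed

section \<open>The approximate diagonal\<close>


lemma l1norm_cls:
  assumes "trig p"
  shows "l1norm (cls p c) = ((\<integral>s. cmod (p s) \<partial>circle_haar) + cmod c) / 2"
  unfolding l1norm_def using cls_integrable[OF assms, of c] circle.prob_space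
  by (subst integral_haarG) simp_all

lemma l1norm_nonneg: "l1norm f \<ge> 0"
  unfolding l1norm_def by (rule Bochner_Integration.integral_nonneg) simp

lemma l1norm_scale: "l1norm (\<lambda>x. c * f x) = cmod c * l1norm f"
  by (simp add: l1norm_def norm_mult)

section \<open>Bilinear forms of norm at most 1\<close>

lemma
  assumes "\<phi> \<in> unit_forms" "f \<in> ZL1" "g \<in> ZL1" "h \<in> ZL1"
  shows form_add_left: "\<phi> (\<lambda>x. f x + g x) h = \<phi> f h + \<phi> g h"
    and form_add_right: "\<phi> h (\<lambda>x. f x + g x) = \<phi> h f + \<phi> h g"
    and form_scale_left: "\<phi> (\<lambda>x. c * f x) h = c * \<phi> f h"
    and form_scale_right: "\<phi> h (\<lambda>x. c * f x) = c * \<phi> h f"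
    and form_bound: "cmod (\<phi> f g) \<le> l1norm f * l1norm g"
  using assms unfolding unit_forms_def mem_Collect_eq by blast+

text \<open>Transposition lets expansions in the first argument be reused for the second.\<close>

lemma unit_forms_swap:
  assumes \<phi>: "\<phi> \<in> unit_forms"
  shows "(\<lambda>f g. \<phi> g f) \<in> unit_forms"
proof -
  have "\<forall>f\<in>ZL1. \<forall>g\<in>ZL1. cmod (\<phi> g f) \<le> l1norm f * l1norm g"
    by (intro ballI, subst mult.commute) (rule form_bound[OF \<phi>])
  with \<phi> show ?thesis
    unfolding unit_forms_def mem_Collect_eq by blast
qed

lemma zero_unit_forms: "(\<lambda>_ _. 0) \<in> unit_forms"
  by (simp add: unit_forms_def l1norm_nonneg)

lemma E_sum_cls:
  "(\<lambda>x. \<Sum>k\<in>A. c k * E (n k) x) = cls (\<lambda>s. \<Sum>k\<in>A. c k * (s powi n k + s powi (- n k))) 0"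
  by (auto simp: fun_eq_iff E_def cls_def)

lemma trig_E_sum:
  assumes "finite A"
  shows "trig (\<lambda>s. \<Sum>k\<in>A. c k * (s powi n k + s powi (- n k)))"
  using assms
proof (induction A rule: finite_induct)
  case empty
  show ?case using trig_const[of 0] by simp
next
  case (insert k A)
  show ?case
    unfolding sum.insert[OF insert(1,2)] by (intro trig.add trig_cmult trig_powi insert.IH)
qed

lemma E_sum_ZL1: "finite A \<Longrightarrow> (\<lambda>x. \<Sum>k\<in>A. c k * E (n k) x) \<in> ZL1"
  unfolding E_sum_cls
  by (intro cls_ZL1 trig_E_sum) (simp_all add: power_int_minus power_int_inverse add.commute)

lemma form_sum_left:
  assumes \<phi>: "\<phi> \<in> unit_forms" and h: "h \<in> ZL1" and "finite A"
  shows "\<phi> (\<lambda>x. \<Sum>k\<in>A. c k * E (n k) x) h = (\<Sum>k\<in>A. c k * \<phi> (E (n k)) h)"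
  using \<open>finite A\<close>
proof (induction A rule: finite_induct)
  case empty
  \<comment> \<open>The empty sum is the zero function, read as \<open>0 * h x\<close>.\<close>
  show ?case using form_scale_left[OF \<phi> h h h, of 0] by simp
next
  case (insert k A)
  then show ?case
    using form_add_left[OF \<phi> ZL1_scale[OF E_ZL1] E_sum_ZL1[OF insert(1)] h]
      form_scale_left[OF \<phi> E_ZL1 h h] by simp
qed

text \<open>Forms act on functions, but the norm bound makes them vanish on null functions, so they
  respect equality almost everywhere.\<close>

lemma form_scale_AE_right:
  assumes \<phi>: "\<phi> \<in> unit_forms" and f: "f \<in> ZL1" and g: "g \<in> ZL1"
    and [measurable]: "h \<in> borel_measurable haarG" and eq: "AE x in haarG. h x = c * g x"
  shows "\<phi> f h = c * \<phi> f g"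
proof -
  note [measurable] = ZL1_measurable[OF g]
  have cg: "(\<lambda>x. c * g x) \<in> ZL1" by (rule ZL1_scale[OF g])
  have h: "h \<in> ZL1"
    using eq by (intro ZL1_cong_AE[OF cg]) (auto elim: AE_mp)
  \<comment> \<open>\<open>w\<close> is the null error and \<open>z\<close> the zero function;
    \<open>w\<close> belongs to \<open>ZL1\<close> because it agrees with \<open>z\<close> almost
    everywhere.\<close>
  define z where "z x = 0 * h x" for x
  define w where "w x = h x + (- c) * g x" for x
  have z: "z \<in> ZL1" unfolding z_def by (rule ZL1_scale[OF h])
  have zw: "AE x in haarG. z x = w x"
    using eq by eventually_elim (simp add: z_def w_def)
  have w: "w \<in> ZL1"
    by (rule ZL1_cong_AE[OF z _ zw]) (simp add: w_def[abs_def])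
  have "l1norm w = (\<integral>x. 0 \<partial>haarG)"
    unfolding l1norm_def
  proof (rule integral_cong_AE)
    show "AE x in haarG. cmod (w x) = 0" using eq by eventually_elim (simp add: w_def)
  qed (use ZL1_measurable[OF w] in simp_all)
  then have "\<phi> f w = 0" using form_bound[OF \<phi> f w w] by simp
  moreover have "h = (\<lambda>x. c * g x + w x)" by (simp add: w_def fun_eq_iff)
  then have "\<phi> f h = \<phi> f (\<lambda>x. c * g x) + \<phi> f w"
    using form_add_right[OF \<phi> cg w f] by simp
  ultimately show ?thesis using form_scale_right[OF \<phi> g g f] by simp
qed

section \<open>The uniform bound obtained by averaging kernels\<close>

lemma kern_inverse:
  assumes "\<And>k. k \<le> 2*N \<Longrightarrow> a (2*N - k) = a k"
  shows "kern a N (inverse s) = kern a N s"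
proof -
  have "kern a N (inverse s) = (\<Sum>k\<le>2*N. of_real (a k) * s powi (int N - int k))"
    unfolding kern_def
    by (intro sum.cong refl) (simp add: power_int_inverse flip: power_int_minus)
  also have "\<dots> = kern a N s"
    unfolding kern_def
    by (rule sum.reindex_bij_witness[where i = "\<lambda>k. 2*N - k" and j = "\<lambda>k. 2*N - k"])
      (auto simp: assms of_nat_diff)
  finally show ?thesis .
qed

text \<open>Pairing \<open>s powi n\<close> with \<open>s powi (- n)\<close> produces the kernel at
  \<open>r * s\<close> and at \<open>r * inverse s\<close>; evenness moves the inverse onto
  \<open>r\<close>. General \<open>r\<close> serves the norm bound, \<open>r = 1\<close> the product
  of the diagonal.\<close>

lemma kern_E_sum:
  assumes "\<And>k. k \<le> 2*N \<Longrightarrow> a (2*N - k) = a k"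
  shows "(\<lambda>x. \<Sum>k\<le>2*N. (of_real (a k) * r powi (int k - int N)) * E (int k - int N) x)
    = cls (\<lambda>s. kern a N (r * s) + kern a N (inverse r * s)) 0"
proof -
  have "(\<Sum>k\<le>2*N. (of_real (a k) * r powi (int k - int N)) * (s powi (int k - int N) + s powi (- (int k - int N))))
      = kern a N (r * s) + kern a N (inverse r * s)" for s
  proof -
    have "kern a N (inverse r * s) = kern a N (r * inverse s)"
      using kern_inverse[of N a "inverse r * s", OF assms] by simp
    then show ?thesis
      by (simp only: kern_def power_int_mult_distrib power_int_inverse power_int_minus
          distrib_left sum.distrib mult.assoc)
  qed
  then show ?thesis unfolding E_sum_cls by (simp only:)
qed

text \<open>In the double expansion of \<open>\<phi> (L r) (L (inverse r))\<close> the term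
  \<open>(k, l)\<close> carries \<open>r powi (int k - int l)\<close>, so averaging over
  \<open>r\<close> leaves \<open>k = l\<close>. The form is applied before averaging, so only scalar
  integrals occur.\<close>

lemma kernel_form_bound:
  assumes \<phi>: "\<phi> \<in> unit_forms"
  shows "cmod (\<Sum>k\<le>2*N. of_real ((kap N k)\<^sup>2) * \<phi> (E (int k - int N)) (E (int k - int N))) \<le> 1"
proof -
  define L where "L r = (\<lambda>x. \<Sum>k\<le>2*N. (of_real (kap N k) * r powi (int k - int N)) * E (int k - int N) x)" for r
  define c where "c k l = of_real (kap N k * kap N l) * \<phi> (E (int k - int N)) (E (int l - int N))" for k l
  have L_cls: "L r = cls (\<lambda>s. kern (kap N) N (r * s) + kern (kap N) N (inverse r * s)) 0" for r
    unfolding L_def by (rule kern_E_sum) (rule kap_sym)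
  have L_ZL1: "L r \<in> ZL1" for r unfolding L_def by (intro E_sum_ZL1) simp
  \<comment> \<open>Each of the two translated kernels has norm 1 on the circle, and the rotations
    carry half the Haar mass: \<open>(1 + 1) / 2 = 1\<close>.\<close>
  have L_norm: "l1norm (L r) \<le> 1" if r: "cmod r = 1" for r
  proof -
    have r': "cmod (inverse r) = 1" using r by (simp add: norm_inverse)
    obtain B where B: "\<forall>t. cmod t = 1 \<longrightarrow> cmod (kern (kap N) N t) \<le> B"
      using trig_bounded[OF trig_kern] by blast
    have int: "integrable circle_haar (\<lambda>s. kern (kap N) N (t * s))" if "cmod t = 1" for t
      using that B by (intro integrable_circle_bounded[of _ B]) (auto simp: norm_mult)
    have Li: "integrable haarG (L r)" by (rule ZL1_integrable[OF L_ZL1])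
    have "l1norm (L r) = (\<integral>s. cmod (kern (kap N) N (r * s) + kern (kap N) N (inverse r * s)) \<partial>circle_haar) / 2"
      unfolding l1norm_def using Li by (subst integral_haarG) (simp_all add: L_cls)
    also have "\<dots> \<le> (\<integral>s. cmod (kern (kap N) N (r * s)) + cmod (kern (kap N) N (inverse r * s)) \<partial>circle_haar) / 2"
      using int[OF r] int[OF r']
      by (intro divide_right_mono integral_mono norm_triangle_ineq) auto
    also have "\<dots> = 1"
      using int[OF r] int[OF r']
      by (simp add: integral_norm_kern[OF pos_kern_kap r] integral_norm_kern[OF pos_kern_kap r'] kap_centre)
    finally show ?thesis .
  qed
  have form: "\<phi> (L r) (L (inverse r)) = (\<Sum>k\<le>2*N. \<Sum>l\<le>2*N. c k l * r powi (int k - int l))" if "r \<noteq> 0" for r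
  proof -
    have "\<phi> (L r) (L (inverse r)) = (\<Sum>k\<le>2*N. (of_real (kap N k) * r powi (int k - int N)) * \<phi> (E (int k - int N)) (L (inverse r)))"
      unfolding L_def[of r] by (intro form_sum_left[OF \<phi> L_ZL1]) simp
    also have "\<dots> = (\<Sum>k\<le>2*N. (of_real (kap N k) * r powi (int k - int N)) *
        (\<Sum>l\<le>2*N. (of_real (kap N l) * inverse r powi (int l - int N)) * \<phi> (E (int k - int N)) (E (int l - int N))))"
      unfolding L_def[of "inverse r"]
      by (intro sum.cong refl arg_cong2[where f = times])
        (rule form_sum_left[OF unit_forms_swap[OF \<phi>] E_ZL1], simp)
    also have "\<dots> = (\<Sum>k\<le>2*N. \<Sum>l\<le>2*N. c k l * r powi (int k - int l))"
      unfolding sum_distrib_left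
    proof (intro sum.cong refl)
      fix k l
      have "r powi (int k - int l) = r powi (int k - int N) * inverse r powi (int l - int N)"
        using that by (simp add: power_int_inverse flip: power_int_minus power_int_add)
      then show "of_real (kap N k) * r powi (int k - int N) *
          (of_real (kap N l) * inverse r powi (int l - int N) * \<phi> (E (int k - int N)) (E (int l - int N)))
        = c k l * r powi (int k - int l)"
        by (simp add: c_def)
    qed
    finally show ?thesis .
  qed
  have "(\<Sum>k\<le>2*N. of_real ((kap N k)\<^sup>2) * \<phi> (E (int k - int N)) (E (int k - int N))) = (\<Sum>k\<le>2*N. c k k)"
    by (simp add: c_def power2_eq_square)
  also have "\<dots> = (\<Sum>k\<le>2*N. \<Sum>l\<le>2*N. c k l * (if k = l then 1 else 0))"
    by (intro sum.cong refl) (simp add: if_distrib cong: if_cong)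
  also have "\<dots> = (\<Sum>k\<le>2*N. \<Sum>l\<le>2*N. c k l * (\<integral>r. r powi (int k - int l) \<partial>circle_haar))"
    by (simp add: integral_circle_powi)
  also have "\<dots> = (\<integral>r. (\<Sum>k\<le>2*N. \<Sum>l\<le>2*N. c k l * r powi (int k - int l)) \<partial>circle_haar)"
    by (simp add: Bochner_Integration.integral_sum)
  also have "cmod \<dots> \<le> (\<integral>r. cmod (\<Sum>k\<le>2*N. \<Sum>l\<le>2*N. c k l * r powi (int k - int l)) \<partial>circle_haar)"
    by (rule integral_norm_bound)
  also have "\<dots> \<le> (\<integral>r. 1 \<partial>circle_haar)"
  proof (rule integral_mono_AE)
    show "AE r in circle_haar. cmod (\<Sum>k\<le>2*N. \<Sum>l\<le>2*N. c k l * r powi (int k - int l)) \<le> 1"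
      using AE_circle
    proof eventually_elim
      case (elim r)
      then have r: "r \<noteq> 0" "cmod (inverse r) = 1" by (auto simp: norm_inverse)
      have "cmod (\<phi> (L r) (L (inverse r))) \<le> l1norm (L r) * l1norm (L (inverse r))"
        by (rule form_bound[OF \<phi> L_ZL1 L_ZL1 L_ZL1])
      also have "\<dots> \<le> 1 * 1"
        using L_norm[OF elim] L_norm[OF r(2)] by (intro mult_mono) (simp_all add: l1norm_nonneg)
      finally show ?case by (simp add: form[OF r(1)])
    qed
  qed simp_all
  finally show ?thesis using circle.prob_space by simp
qed

text \<open>Slot \<open>k \<le> 2 N\<close>, \<open>k \<noteq> N\<close>, carries the frequency \<open>k - N\<close>, so each idempotent occurs twice
  (as \<open>E m\<close> and \<open>E (- m)\<close>); the two characters sit in the slots \<open>N\<close> and \<open>2 N + 1\<close>.\<close>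

definition diag_v :: "nat \<Rightarrow> nat \<Rightarrow> fn" where
  "diag_v N k = (if k = N then chi 1 else if k \<le> 2*N then E (int k - int N) else chi (-1))"

text \<open>With \<open>e = 2 * E m\<close>, the tensor square of \<open>e\<close> is 4 times that
  of \<open>E m\<close>; the slots of \<open>m\<close> and \<open>- m\<close> share it, hence the
  factor 2. Beyond slot \<open>2*N+1\<close> the coefficient 0 makes every series finite.\<close>

definition diag_d :: "nat \<Rightarrow> nat \<Rightarrow> complex" where
  "diag_d N k = (if k = N \<or> k = 2*N+1 then 1 else if k \<le> 2*N then 2 * of_real ((kap N k)\<^sup>2) else 0)"

definition diag :: "nat \<Rightarrow> tens" where
  "diag N = ((\<lambda>k x. diag_d N k * diag_v N k x), diag_v N)"

lemma diag_v_ZL1: "diag_v N k \<in> ZL1"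
  by (simp add: diag_v_def chi_ZL1 E_ZL1)

lemma diag_v_eigen:
  assumes "a \<in> ZL1"
  shows "\<exists>c. conv a (diag_v N k) = (\<lambda>x. c * diag_v N k x)"
proof -
  have chi: "\<exists>z. conv a (chi c) = (\<lambda>x. z * chi c x)" if "c\<^sup>2 = 1" for c
    by (rule exI) (rule conv_chi_eigen[OF ZL1_integrable[OF assms] that])
  have E: "\<exists>z. conv a (E m) = (\<lambda>x. z * E m x)" if "m \<noteq> 0" for m
    by (rule exI) (rule conv_E_eigen[OF assms that])
  show ?thesis
    by (simp add: diag_v_def chi E)
qed

lemma valid_diag: "valid_tens (diag N)"
  unfolding valid_tens_def diag_def fst_conv snd_conv
proof (intro conjI allI)
  show "(\<lambda>x. diag_d N k * diag_v N k x) \<in> ZL1" for k by (intro ZL1_scale diag_v_ZL1)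
  show "diag_v N k \<in> ZL1" for k by (rule diag_v_ZL1)
  show "summable (\<lambda>k. l1norm (\<lambda>x. diag_d N k * diag_v N k x) * l1norm (diag_v N k))"
    unfolding l1norm_scale by (rule summable_finite[of "{..2*N+1}"]) (auto simp: diag_d_def)
qed

text \<open>Slot \<open>N\<close> holds a character instead of frequency 0. Filling that frequency
  in, with weight \<open>kap N N = 1\<close>, completes the sum to the one controlled by averaging
  and costs the correction \<open>2 * F (E 0)\<close>.\<close>

lemma diag_split:
  fixes F :: "fn \<Rightarrow> complex"
  shows "(\<Sum>k. diag_d N k * F (diag_v N k))
    = F (chi 1) + F (chi (-1)) + 2 * (\<Sum>k\<le>2*N. of_real ((kap N k)\<^sup>2) * F (E (int k - int N))) - 2 * F (E 0)"
proof -
  have "(\<Sum>k. diag_d N k * F (diag_v N k)) = (\<Sum>k\<le>2*N+1. diag_d N k * F (diag_v N k))"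
    by (rule suminf_finite) (auto simp: diag_d_def)
  also have "\<dots> = F (chi (-1)) + (\<Sum>k\<le>2*N. diag_d N k * F (diag_v N k))"
    by (simp add: diag_d_def diag_v_def)
  also have "(\<Sum>k\<le>2*N. diag_d N k * F (diag_v N k))
    = F (chi 1) + (\<Sum>k\<in>{..2*N} - {N}. 2 * of_real ((kap N k)\<^sup>2) * F (E (int k - int N)))"
    by (subst sum.remove[of _ N]) (auto simp: diag_d_def diag_v_def intro!: sum.cong)
  also have "(\<Sum>k\<in>{..2*N} - {N}. 2 * of_real ((kap N k)\<^sup>2) * F (E (int k - int N)))
    = (\<Sum>k\<le>2*N. 2 * of_real ((kap N k)\<^sup>2) * F (E (int k - int N))) - 2 * F (E 0)"
    by (subst sum.remove[of "{..2*N}" N]) (auto simp: kap_centre)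
  finally show ?thesis by (simp add: sum_distrib_left mult.assoc)
qed

lemma E_0: "E 0 = cls (\<lambda>_. 2) 0"
  by (simp add: E_def)

lemma pair_diag_bound:
  assumes \<phi>: "\<phi> \<in> unit_forms"
  shows "cmod (pair \<phi> (diag N)) \<le> 6"
proof -
  let ?S = "\<Sum>k\<le>2*N. of_real ((kap N k)\<^sup>2) * \<phi> (E (int k - int N)) (E (int k - int N))"
  have "pair \<phi> (diag N) = (\<Sum>k. diag_d N k * \<phi> (diag_v N k) (diag_v N k))"
    by (simp add: pair_def diag_def form_scale_left[OF \<phi> diag_v_ZL1 diag_v_ZL1 diag_v_ZL1])
  also have "\<dots> = \<phi> (chi 1) (chi 1) + \<phi> (chi (-1)) (chi (-1)) + 2 * ?S - 2 * \<phi> (E 0) (E 0)"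
    by (rule diag_split[where F = "\<lambda>f. \<phi> f f"])
  finally have eq: "pair \<phi> (diag N) = \<phi> (chi 1) (chi 1) + \<phi> (chi (-1)) (chi (-1)) + 2 * ?S - 2 * \<phi> (E 0) (E 0)" .
  have b: "cmod (\<phi> f f) \<le> 1" if "f \<in> ZL1" "l1norm f = 1" for f
    using form_bound[OF \<phi> that(1) that(1) that(1)] that(2) by simp
  have "cmod (\<phi> (chi 1) (chi 1)) \<le> 1" "cmod (\<phi> (chi (-1)) (chi (-1))) \<le> 1" "cmod (\<phi> (E 0) (E 0)) \<le> 1"
    using circle.prob_space
    by (intro b chi_ZL1 E_ZL1; simp add: chi_def E_0 l1norm_cls[OF trig_const])+
  \<comment> \<open>The constant 6: two characters and the completed sum, which counts twice, plus
    the correction by \<open>E 0\<close>, which also counts twice.\<close>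
  then have "cmod (pair \<phi> (diag N)) \<le> 1 + 1 + 2 * 1 + 2 * 1"
    unfolding eq using kernel_form_bound[OF \<phi>, of N]
    by (intro order_trans[OF norm_triangle_ineq4] order_trans[OF norm_triangle_ineq] add_mono)
      (simp_all add: norm_mult)
  then show ?thesis by simp
qed

text \<open>Slot by slot both sides are the eigenvalue times the same number. On the left the
  eigenvalue equation is an equality of functions; on the right it comes from centrality and holds
  only almost everywhere.\<close>

lemma pair_lact_ract:
  assumes \<phi>: "\<phi> \<in> unit_forms" and a: "a \<in> ZL1"
  shows "pair \<phi> (lact a (diag N)) = pair \<phi> (ract (diag N) a)"
proof -
  have "\<phi> (conv a (\<lambda>x. diag_d N k * diag_v N k x)) (diag_v N k)
      = \<phi> (\<lambda>x. diag_d N k * diag_v N k x) (conv (diag_v N k) a)" for k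
  proof -
    let ?v = "diag_v N k" and ?u = "\<lambda>x. diag_d N k * diag_v N k x"
    obtain c where c: "conv a ?v = (\<lambda>x. c * ?v x)"
      using diag_v_eigen[OF a] by blast
    have v: "?v \<in> ZL1" and u: "?u \<in> ZL1" by (intro diag_v_ZL1 ZL1_scale)+
    have "conv a ?u = (\<lambda>x. c * ?u x)"
      by (simp add: conv_scale_right c fun_eq_iff)
    then have "\<phi> (conv a ?u) ?v = c * \<phi> ?u ?v"
      using form_scale_left[OF \<phi> u v v] by simp
    also have "\<dots> = \<phi> ?u (conv ?v a)"
    proof (rule form_scale_AE_right[OF \<phi> u v, symmetric])
      show "conv ?v a \<in> borel_measurable haarG"
        by (intro conv_measurable ZL1_measurable v a)
      show "AE x in haarG. conv ?v a x = c * ?v x"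
        using ZL1_commute[OF v ZL1_integrable[OF a]] by (simp add: c)
    qed
    finally show ?thesis .
  qed
  then show ?thesis
    by (simp add: pair_def lact_def ract_def diag_def)
qed

lemma fourier_E_sheet: "m \<noteq> 0 \<Longrightarrow> fourier (sheet (E m) 1) m = 1"
proof -
  assume m: "m \<noteq> 0"
  have "fourier (sheet (E m) 1) m = fourier (\<lambda>s. s powi m) m + fourier (\<lambda>s. s powi (- m)) m"
    using integrable_mult_powi[OF integrable_powi] by (simp add: fourier_def E_def distrib_right)
  then show ?thesis using m by (simp add: fourier_powi)
qed

text \<open>The characters are idempotent, whereas \<open>E m\<close>, being half an idempotent,
  squares to half of itself.\<close>

lemma conv_diag:
  "conv (\<lambda>x. diag_d N k * diag_v N k x) (diag_v N k) x
    = diag_d N k * (if k = N \<or> k > 2*N then diag_v N k x else diag_v N k x / 2)"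
proof -
  have one: "fourier (\<lambda>_. z) 0 = z" for z
    using circle.prob_space by (simp add: fourier_def)
  have chi: "conv (chi c) (chi c) = chi c" if "c\<^sup>2 = 1" for c
    using conv_chi_eigen[OF ZL1_integrable[OF chi_ZL1] that, of c] that
    by (simp add: chi_def one power2_eq_square)
  have "conv (E m) (E m) = (\<lambda>x. E m x / 2)" if "m \<noteq> 0" for m
    using conv_E_eigen[OF E_ZL1 that, of m] fourier_E_sheet[OF that] by simp
  then show ?thesis
    by (simp add: conv_scale_left diag_v_def chi)
qed

text \<open>The 2 in \<open>diag_d\<close> cancels the 1/2 from squaring \<open>E m\<close>, and the
  two characters add up to \<open>E 0\<close>, exactly the missing term of frequency 0. Evenness
  doubles the kernel.\<close>

lemma mult_diag: "mult_tens (diag N) = cls (\<lambda>s. 2 * kern (\<lambda>k. (kap N k)\<^sup>2) N s) 0"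
proof
  fix x
  have "mult_tens (diag N) x = (\<Sum>k\<le>2*N+1. diag_d N k * (if k = N \<or> k > 2*N then diag_v N k x else diag_v N k x / 2))"
    unfolding mult_tens_def diag_def fst_conv snd_conv conv_diag
    by (rule suminf_finite) (auto simp: diag_d_def)
  also have "\<dots> = chi (-1) x + (\<Sum>k\<le>2*N. diag_d N k * (if k = N \<or> k > 2*N then diag_v N k x else diag_v N k x / 2))"
    by (simp add: diag_d_def diag_v_def)
  also have "(\<Sum>k\<le>2*N. diag_d N k * (if k = N \<or> k > 2*N then diag_v N k x else diag_v N k x / 2))
    = chi 1 x + (\<Sum>k\<in>{..2*N} - {N}. of_real ((kap N k)\<^sup>2) * E (int k - int N) x)"
    by (subst sum.remove[of _ N]) (auto simp: diag_d_def diag_v_def intro!: sum.cong)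
  also have "(\<Sum>k\<in>{..2*N} - {N}. of_real ((kap N k)\<^sup>2) * E (int k - int N) x)
    = (\<Sum>k\<le>2*N. of_real ((kap N k)\<^sup>2) * E (int k - int N) x) - E 0 x"
    by (subst sum.remove[of "{..2*N}" N]) (auto simp: kap_centre)
  also have "chi (-1) x + (chi 1 x + \<dots>) = (\<Sum>k\<le>2*N. of_real ((kap N k)\<^sup>2) * E (int k - int N) x)"
    by (simp add: chi_def E_0 cls_def split: prod.split)
  also have "\<dots> = cls (\<lambda>s. 2 * kern (\<lambda>k. (kap N k)\<^sup>2) N s) 0 x"
    using fun_cong[OF kern_E_sum[of N "\<lambda>k. (kap N k)\<^sup>2" 1], of x] by (simp add: kap_sym)
  finally show "mult_tens (diag N) x = cls (\<lambda>s. 2 * kern (\<lambda>k. (kap N k)\<^sup>2) N s) 0 x" .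
qed

lemma mult_diag_ZL1: "mult_tens (diag N) \<in> ZL1"
  unfolding mult_diag
  by (intro cls_ZL1 trig_cmult trig_kern) (simp add: kern_inverse kap_sym)

text \<open>Since the kernel is even, convolving acts on the reflections as it does on the
  rotations: by circle convolution on each sheet, the factor 2 cancelling the mass 1/2.\<close>

lemma l1norm_conv_mult_diag:
  assumes a: "integrable haarG a"
  shows "l1norm (\<lambda>x. conv a (mult_tens (diag N)) x - a x)
    = ((\<integral>t. cmod (cconv (sheet a 1) (kern (\<lambda>k. (kap N k)\<^sup>2) N) t - a (t, 1)) \<partial>circle_haar)
     + (\<integral>t. cmod (cconv (sheet a (-1)) (kern (\<lambda>k. (kap N k)\<^sup>2) N) t - a (t, -1)) \<partial>circle_haar)) / 2"
proof -
  let ?J = "kern (\<lambda>k. (kap N k)\<^sup>2) N" and ?m = "mult_tens (diag N)"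
  have int: "integrable circle_haar (sheet a 1)" "integrable circle_haar (sheet a (-1))"
    using integrable_haarG_sheet[OF a] by simp_all
  have meas [measurable]: "a \<in> borel_measurable haarG" "?m \<in> borel_measurable haarG"
    using a ZL1_measurable[OF mult_diag_ZL1] by auto
  have J: "?J (s * inverse t) = ?J (inverse s * t)" for s t
    using kern_inverse[of N "\<lambda>k. (kap N k)\<^sup>2" "inverse s * t"] by (simp add: kap_sym)
  have J_int: "integrable circle_haar (\<lambda>s. F s * ?J (inverse s * t))" if F: "integrable circle_haar F" for F t
  proof -
    \<comment> \<open>Expansion into powers gives integrability for every complex \<open>t\<close>,
      as the sheet formulas below are stated for all \<open>t\<close>.\<close>
    have "(\<lambda>s. F s * ?J (inverse s * t)) = (\<lambda>s. \<Sum>k\<le>2*N.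
        (of_real ((kap N k)\<^sup>2) * t powi (int k - int N)) * (F s * s powi (- (int k - int N))))"
      unfolding kern_def sum_distrib_left
      by (intro ext sum.cong refl)
        (simp only: power_int_mult_distrib power_int_minus power_int_inverse mult_ac)
    then show ?thesis using integrable_mult_powi[OF F] by simp
  qed
  have sheets: "conv a ?m (t, 1) = cconv (sheet a 1) ?J t" "conv a ?m (t, -1) = cconv (sheet a (-1)) ?J t" for t
    using J_int[OF int(1)] J_int[OF int(2)]
    by (subst conv_sheets[OF meas]; simp add: mult_diag cconv_def J mult.left_commute[of _ 2])+
  have "integrable haarG (conv a ?m)"
    using int conv_measurable[OF meas]
    by (subst integrable_haarG_iff) (auto simp: sheets intro!: trig_integrable trig_cconv_kern)
  then have "integrable haarG (\<lambda>x. cmod (conv a ?m x - a x))" using a by simp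
  from integral_haarG[OF this] show ?thesis by (simp add: l1norm_def sheets)
qed

theorem theorem1p11:
  shows "ZL1_amenable"
  unfolding ZL1_amenable_def
proof (intro exI[of _ "filtermap diag sequentially"] exI[of _ "6 :: real"] conjI ballI)
  show "filtermap diag sequentially \<noteq> bot"
    by (simp add: filtermap_bot_iff)
  \<comment> \<open>The zero form makes the index set of the supremum nonempty.\<close>
  have "proj_norm (\<lambda>\<phi>. pair \<phi> (diag N)) \<le> 6" for N
    unfolding proj_norm_def using zero_unit_forms
    by (intro cSUP_least pair_diag_bound) auto
  then show "\<forall>\<^sub>F \<mu> in filtermap diag sequentially. valid_tens \<mu> \<and> proj_norm (\<lambda>\<phi>. pair \<phi> \<mu>) \<le> 6"
    by (simp add: eventually_filtermap valid_diag)
  fix a assume a: "a \<in> ZL1"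
  have ai: "integrable haarG a" by (rule ZL1_integrable[OF a])
  have "(\<lambda>N. l1norm (\<lambda>x. conv a (mult_tens (diag N)) x - a x)) \<longlonglongrightarrow> (0 + 0) / 2"
    unfolding l1norm_conv_mult_diag[OF ai]
    by (intro tendsto_divide tendsto_add cconv_approx tendsto_const integrable_haarG_sheet[OF ai]) auto
  then have right: "(\<lambda>N. l1norm (\<lambda>x. conv a (mult_tens (diag N)) x - a x)) \<longlonglongrightarrow> 0"
    by simp
  \<comment> \<open>The product of the diagonal is itself central, so the left-hand limit reduces to
    the right-hand one.\<close>
  have "l1norm (\<lambda>x. conv (mult_tens (diag N)) a x - a x) = l1norm (\<lambda>x. conv a (mult_tens (diag N)) x - a x)" for N
    unfolding l1norm_def
  proof (rule integral_cong_AE)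
    note [measurable] = ZL1_measurable[OF a] ZL1_measurable[OF mult_diag_ZL1] conv_measurable
    show "(\<lambda>x. cmod (conv (mult_tens (diag N)) a x - a x)) \<in> borel_measurable haarG"
        "(\<lambda>x. cmod (conv a (mult_tens (diag N)) x - a x)) \<in> borel_measurable haarG"
      by measurable
    show "AE x in haarG. cmod (conv (mult_tens (diag N)) a x - a x) = cmod (conv a (mult_tens (diag N)) x - a x)"
      using ZL1_commute[OF mult_diag_ZL1[of N] ai] by eventually_elim simp
  qed
  with right show "((\<lambda>\<mu>. l1norm (\<lambda>x. conv (mult_tens \<mu>) a x - a x)) \<longlongrightarrow> 0) (filtermap diag sequentially)"
    by (simp add: filterlim_filtermap)
  from right show "((\<lambda>\<mu>. l1norm (\<lambda>x. conv a (mult_tens \<mu>) x - a x)) \<longlongrightarrow> 0) (filtermap diag sequentially)"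
    by (simp add: filterlim_filtermap)
  have "proj_norm (\<lambda>\<phi>. pair \<phi> (lact a (diag N)) - pair \<phi> (ract (diag N) a)) = 0" for N
  proof -
    have "proj_norm (\<lambda>\<phi>. pair \<phi> (lact a (diag N)) - pair \<phi> (ract (diag N) a)) = (SUP \<phi>\<in>unit_forms. 0)"
      unfolding proj_norm_def by (intro SUP_cong refl) (simp add: pair_lact_ract[OF _ a])
    also have "\<dots> = 0" using zero_unit_forms by (intro cSUP_const) auto
    finally show ?thesis .
  qed
  then show "((\<lambda>\<mu>. proj_norm (\<lambda>\<phi>. pair \<phi> (lact a \<mu>) - pair \<phi> (ract \<mu> a))) \<longlongrightarrow> 0) (filtermap diag sequentially)"
    by (simp add: filterlim_filtermap)
qed

end
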